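(* In the following statements let $\emptyset\subseteq I\subseteq[n-1]^2$, $B\in\{0,\pm\}^I$ and $\mathcal{E}_B:=\mathcal{E}_B^{[n-1]^2}$; all asymptotic statements are for $n\to\infty$. (Ex3) For each of the $\sum_{0\le k\le3}3^k\binom{(n-1)^2}{k}\sim\tfrac92n^6$ possible events $\mathcal{E}_B$ with $0\le\mathrm{dom}(B)\le3$, it is true that $\mathsf{P}_{\mathrm{chio}}[\mathcal{E}_B]=\mathsf{P}_{\mathrm{lcf}}[\mathcal{E}_B]=(\tfrac12)^{\mathrm{dom}(B)+\mathrm{supp}(B)}$. (Ex4) Among the $3^4\binom{(n-1)^2}{4}\sim\tfrac{27}{8}n^8$ possible events $\mathcal{E}_B$ with $\mathrm{dom}(B)=4$, there are precisely $|\mathcal{F}(4,n)|=2^4\binom{n-1}{2}\binom{n-1}{2}\sim4n^4$ events for which $\mathsf{P}_{\mathrm{chio}}[\mathcal{E}_B]=\mathsf{P}_{\mathrm{lcf}}[\mathcal{E}_B]$ does not hold. Of these, we have $\frac{|\mathcal{F}_{\cdot0}(4,n)|}{|\mathcal{F}(4,n)|}=\frac{|\mathcal{F}_{\cdot2}(4,n)|}{|\mathcal{F}(4,n)|}=\tfrac12$. (Ex5) Among the $3^5\binom{(n-1)^2}{5}\sim\tfrac{81}{40}n^{10}$ different events $\mathcal{E}_B$ with $\mathrm{dom}(B)=5$, there are precisely $|\mathcal{F}(5,n)|=48\,((n-1)^2-4)\binom{n-1}{2}\binom{n-1}{2}\sim12n^6$ events for which $\mathsf{P}_{\mathrm{chio}}[\mathcal{E}_B]=\mathsf{P}_{\mathrm{lcf}}[\mathcal{E}_B]$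 does not hold. Of these, we have $\frac{|\mathcal{F}_{\cdot0}(5,n)|}{|\mathcal{F}(5,n)|}=\frac{|\mathcal{F}_{\cdot2}(5,n)|}{|\mathcal{F}(5,n)|}=\tfrac12$. (Ex6) Among the $3^6\binom{(n-1)^2}{6}\sim\tfrac{81}{80}n^{12}$ different events $\mathcal{E}_B$ with $\mathrm{dom}(B)=6$, there are precisely $$|\mathcal{F}(6,n)|=18n^8-180n^7+\tfrac{1868}{3}n^6-\tfrac{2176}{3}n^5-\tfrac{754}{3}n^4+\tfrac{428}{3}n^3+\tfrac{8144}{3}n^2-\tfrac{11536}{3}n+1504\sim18n^8$$ events for which $\mathsf{P}_{\mathrm{chio}}[\mathcal{E}_B]=\mathsf{P}_{\mathrm{lcf}}[\mathcal{E}_B]$ does not hold. Of these, we have $$|\mathcal{F}_{\cdot0}(6,n)|=9n^8-90n^7+\tfrac{934}{3}n^6-360n^5-\tfrac{449}{3}n^4+154n^3+\tfrac{3664}{3}n^2-1816n+720\sim9n^8,$$ $$|\mathcal{F}_{\cdot2}(6,n)|=9n^8-90n^7+\tfrac{934}{3}n^6-368n^5-\tfrac{233}{3}n^4-94n^3+\tfrac{4888}{3}n^2-2136n+816\sim9n^8,$$ $$|\mathcal{F}_{\cdot4}(6,n)|=\tfrac83n^5-24n^4+\tfrac{248}{3}n^3-136n^2+\tfrac{320}{3}n-32\sim\tfrac83n^5,$$ hence in particular $\lim_{n\to\infty}\frac{|\mathcal{F}_{\cdot0}(6,n)|}{|\mathcal{F}(6,n)|}=\lim_{n\to\infty}\frac{|\mathcal{F}_{\cdot2}(6,n)|}{|\mathcal{F}(6,n)|}=\tfrac12$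 and $\lim_{n\to\infty}\frac{|\mathcal{F}_{\cdot4}(6,n)|}{|\mathcal{F}(6,n)|}=0$.
   Context: Throughout, $n\ge2$ is an integer. Notation: $[n]=\{1,\dots,n\}$, $\{\pm\}=\{-1,+1\}$, $\{0,\pm\}=\{-1,0,+1\}$. For $B\in\{0,\pm\}^I$ put $\mathrm{dom}(B)=|I|$ and $\mathrm{supp}(B)=|\{(i,j)\in I:B[i,j]\ne0\}|$. For a set $M$, $\binom{M}{k}$ is the set of its $k$-element subsets. Chio measure on $\{0,\pm\}^{[n-1]^2}$: $\mathsf{P}_{\mathrm{chio}}[\mathcal{B}]:=2^{-n^2}\,\bigl|\{A\in\{\pm\}^{[n]^2}:\tfrac12C_{(n,n)}(A)\in\mathcal{B}\}\bigr|$, where for $A=(a_{i,j})$, $\tfrac12C_{(n,n)}(A):=\bigl(\tfrac12(a_{i,j}a_{n,n}-a_{i,n}a_{n,j})\bigr)_{(i,j)\in[n-1]^2}$. Lazy coin flip measure $\mathsf{P}_{\mathrm{lcf}}$ on $\{0,\pm\}^{[n-1]^2}$: the entries are independent, each taking the values $-1,0,+1$ with probabilities $\tfrac14,\tfrac12,\tfrac14$. Entry-specification event: for $B\in\{0,\pm\}^I$, $\mathcal{E}_B^{[n-1]^2}:=\{\tilde B\in\{0,\pm\}^{[n-1]^2}:\tilde B|_I=B\}$. Events $\mathcal{E}_B$ are counted by counting the $B$. Failure sets: $\mathcal{F}(k,n):=\{B\in\{0,\pm\}^I: I\in\binom{[n-1]^2}{k},\ \mathsf{P}_{\mathrm{chio}}[\mathcal{E}_B]\ne\mathsf{P}_{\mathrm{lcf}}[\mathcal{E}_B]\}$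 (union over all such $I$), and for $\ell\in\mathbb{Q}_{\ge0}$, $\mathcal{F}_{\cdot\ell}(k,n):=\{B\in\mathcal{F}(k,n):\mathsf{P}_{\mathrm{chio}}[\mathcal{E}_B]=\ell\cdot\mathsf{P}_{\mathrm{lcf}}[\mathcal{E}_B]\}$. *)

theory Defs
  imports "HOL-Probability.Probability" "HOL-Library.Landau_Symbols"
begin

definition square :: "nat \<Rightarrow> (nat \<times> nat) set" where
  "square m = {1..m} \<times> {1..m}"

text \<open>
  An array \<open>B \<in> {0,\<plusminus>}\<^sup>I\<close> is a partial map whose domain is exactly \<open>I\<close>. So \<open>B\<close> determines \<open>I\<close>,
  and arrays on different index sets are different.
\<close>

type_synonym array = "nat \<times> nat \<Rightarrow> int option"

definition arrays :: "(nat \<times> nat) set \<Rightarrow> array set" where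
  "arrays I = {B. dom B = I \<and> ran B \<subseteq> {-1, 0, 1}}"

definition entry_specs :: "nat \<Rightarrow> array set" where
  "entry_specs n = (\<Union>I\<in>Pow (square (n - 1)). arrays I)"

definition dom_size :: "array \<Rightarrow> nat" where
  "dom_size B = card (dom B)"

definition supp_size :: "array \<Rightarrow> nat" where
  "supp_size B = card {p \<in> dom B. B p \<noteq> Some 0}"

text \<open>
  The integer division below is exact on sign matrices, as a difference of two products of signs
  is even.
\<close>

definition half_chio :: "nat \<Rightarrow> (nat \<times> nat \<Rightarrow> int) \<Rightarrow> array" where
  "half_chio n A =
     (\<lambda>(i, j). Some ((A (i, j) * A (n, n) - A (i, n) * A (n, j)) div 2)) |` square (n - 1)"

definition P_chio :: "nat \<Rightarrow> array set \<Rightarrow> real" where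
  "P_chio n \<B> = real (card {A \<in> square n \<rightarrow>\<^sub>E {-1, 1}. half_chio n A \<in> \<B>}) / 2 ^ (n\<^sup>2)"

definition lazy_coin :: "int pmf" where
  "lazy_coin = pmf_of_list [(-1, 1/4), (0, 1/2), (1, 1/4)]"

lemma pmf_lazy_coin:
  "pmf lazy_coin (-1) = 1/4" "pmf lazy_coin 0 = 1/2" "pmf lazy_coin 1 = 1/4"
proof -
  have "pmf_of_list_wf [(-1 :: int, 1/4 :: real), (0, 1/2), (1, 1/4)]"
    by (rule pmf_of_list_wfI) auto
  then show "pmf lazy_coin (-1) = 1/4" "pmf lazy_coin 0 = 1/2" "pmf lazy_coin 1 = 1/4"
    by (simp_all add: lazy_coin_def pmf_pmf_of_list)
qed

text \<open>
  The default value \<open>None\<close> outside the square makes samples partial maps with domain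
  \<open>square (n - 1)\<close>.
\<close>

definition lcf_pmf :: "nat \<Rightarrow> array pmf" where
  "lcf_pmf n = Pi_pmf (square (n - 1)) None (\<lambda>_. map_pmf Some lazy_coin)"

definition P_lcf :: "nat \<Rightarrow> array set \<Rightarrow> real" where
  "P_lcf n \<B> = measure_pmf.prob (lcf_pmf n) \<B>"

definition entry_event :: "nat \<Rightarrow> array \<Rightarrow> array set" where
  "entry_event n B = {B' \<in> arrays (square (n - 1)). B' |` dom B = B}"

definition failures :: "nat \<Rightarrow> nat \<Rightarrow> array set" where
  "failures k n =
     {B. \<exists>I \<subseteq> square (n - 1). card I = k \<and> B \<in> arrays I \<and>
           P_chio n (entry_event n B) \<noteq> P_lcf n (entry_event n B)}"

definition failures_ratio :: "rat \<Rightarrow> nat \<Rightarrow> nat \<Rightarrow> array set" where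
  "failures_ratio l k n =
     {B \<in> failures k n. P_chio n (entry_event n B) = of_rat l * P_lcf n (entry_event n B)}"

end

theory Submission
  imports Defs "HOL-Real_Asymp.Real_Asymp"
begin

text \<open>
  Condition on the last row and column of the sign matrix. A specified entry \<open>0\<close> or \<open>\<plusminus>1\<close> then fixes
  one inner sign, and an entry \<open>b \<noteq> 0\<close> imposes in addition \<open>u\<^sub>i v\<^sub>j = -b\<close> on the border signs.
  Hence the Chio probability depends on the signed bipartite graph \<open>supp B\<close> only: expanding the
  product of the factors \<open>(1 - b u\<^sub>i v\<^sub>j) / 2\<close> and averaging over the border signs, only the
  subgraphs with all degrees even survive, and the ratio of the two probabilities is the sum of
  the signs of the elements of the cycle space. This sum is the order of the cycle space if all
  cycles are positive and \<open>0\<close> otherwise.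

  With at most six edges the nonempty elements of the cycle space are the cycles of length four
  and six, and there is at most one of them unless the support is a \<open>2 \<times> 3\<close> or \<open>3 \<times> 2\<close> box, which
  has three. As the mean of the ratio over all signs is \<open>1\<close>, the events with cycle space of order
  \<open>e\<close> have ratio \<open>e\<close> for a proportion \<open>1 / e\<close> and ratio \<open>0\<close> otherwise. It remains to count
  boxes and hexagons.
\<close>

section \<open>Chio measure and cycle space\<close>

(* Quantified cells must stay variables: split into coordinates they no longer match the facts about cells. *)
declare split_paired_All [simp del] split_paired_Ex [simp del]

text \<open>The supports of five or six cells that contain a cycle have many shapes, and the proof
  never lists them. Instead, pairs of an array \<open>B\<close> and a nonempty cycle
  \<open>T\<close> inside its support are counted in two ways. For fixed \<open>T\<close>,
  prescribing only \<open>T \<subseteq> supp B\<close> leaves a product of powers of 2 and 3 with a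
  binomial coefficient; for fixed \<open>B\<close> with cycle space of order e there are e - 1
  choices of \<open>T\<close>. If N_e denotes the number of arrays with cycle space of order e, this
  determines N_2 + 3 N_4. The number N_4 is accessible separately, because a box of six cells
  contained in a support of at most six cells is the whole support. The ratios 2, 4 and 0 then occur
  N_2 / 2, N_4 / 4 and N_2 / 2 + 3 N_4 / 4 times. For six specified entries the leading term 9 n^8
  comes from a 2 x 2 box with two arbitrary further cells; hexagons contribute only in order n^6,
  and 2 x 3 boxes only in order n^5.\<close>

definition supp :: "array \<Rightarrow> (nat \<times> nat) set" where
  "supp B = {p \<in> dom B. B p \<noteq> Some 0}"

text \<open>
  A set of cells is a set of edges of the bipartite graph between rows and columns;
  \<open>cycle_space S\<close> is the cycle space over the two-element field of the graph \<open>S\<close>.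
\<close>

definition cycle_space :: "('a \<times> 'b) set \<Rightarrow> ('a \<times> 'b) set set" where
  "cycle_space S = {T. T \<subseteq> S \<and> (\<forall>i. even (card {p \<in> T. fst p = i})) \<and>
     (\<forall>j. even (card {p \<in> T. snd p = j}))}"

text \<open>A character sum: sending \<open>T\<close> to the product of the signs
  \<open>- the (B p)\<close> is a homomorphism from the cycle space to the signs. The minus sign is
  that of the border condition attached to a nonzero entry.\<close>

definition chio_ratio :: "array \<Rightarrow> int" where
  "chio_ratio B = (\<Sum>T\<in>cycle_space (supp B). \<Prod>p\<in>T. - the (B p))"

definition border :: "nat \<Rightarrow> (nat \<times> nat) set" where
  "border n = square n - square (n - 1)"

lemma finite_square [simp, intro]: "finite (square m)"
  by (simp add: square_def)

lemma card_square [simp]: "card (square m) = m\<^sup>2"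
  by (simp add: square_def power2_eq_square)

lemma finite_border [simp, intro]: "finite (border n)"
  by (simp add: border_def)

lemma square_mono: "square (n - 1) \<subseteq> square n"
  by (auto simp: square_def)

lemma square_border: "square n = border n \<union> square (n - 1)"
  using square_mono by (auto simp: border_def)

lemma card_border: "n \<ge> 1 \<Longrightarrow> n\<^sup>2 = card (border n) + (n - 1)\<^sup>2"
  by (metis Diff_disjoint Int_commute border_def card_Un_disjoint card_square finite_border
      finite_square square_border)

text \<open>The two inequalities keep row signs and column signs apart: for inner cells neither kind
  ever sits at the corner, so one kind can be changed without touching the other.\<close>

lemma border_cells:
  assumes "p \<in> square (n - 1)"
  shows "(fst p, n) \<in> border n" "(n, snd p) \<in> border n" "(n, n) \<in> border n"
    "(fst p, n) \<noteq> (n, j)" "(n, snd p) \<noteq> (i, n)"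
  using assms by (auto simp: border_def square_def)

section \<open>Averaging over the border signs\<close>

lemma sum_sign_reversing_involution:
  fixes f :: "'a \<Rightarrow> int"
  assumes "\<And>x. x \<in> X \<Longrightarrow> g x \<in> X" "\<And>x. x \<in> X \<Longrightarrow> g (g x) = x" "\<And>x. x \<in> X \<Longrightarrow> f (g x) = - f x"
  shows "sum f X = 0"
proof -
  have "sum f X = (\<Sum>x\<in>X. f (g x))"
    by (rule sum.reindex_bij_witness[of _ g g]) (use assms in auto)
  also have "\<dots> = - sum f X"
    using assms(3) by (simp add: sum_negf)
  finally show ?thesis by simp
qed

lemma prod_even_multiplicities:
  fixes h :: "'b \<Rightarrow> int"
  assumes "finite T" "\<And>x. x \<in> T \<Longrightarrow> h (g x) \<in> {-1, 1}" "\<And>i. even (card {x \<in> T. g x = i})"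
  shows "(\<Prod>x\<in>T. h (g x)) = 1"
proof -
  have "(\<Prod>x\<in>T. h (g x)) = (\<Prod>i\<in>g ` T. \<Prod>x\<in>{x \<in> T. g x = i}. h (g x))"
    by (rule prod.image_gen) fact
  also have "\<dots> = (\<Prod>i\<in>g ` T. h i ^ card {x \<in> T. g x = i})"
    by (intro prod.cong) auto
  also have "\<dots> = 1"
  proof (rule prod.neutral, rule ballI)
    fix i assume "i \<in> g ` T"
    then have "h i = 1 \<or> h i = -1"
      using assms(2) by auto
    with assms(3)[of i] show "h i ^ card {x \<in> T. g x = i} = 1"
      by auto
  qed
  finally show ?thesis .
qed

lemma prod_flip:
  fixes h :: "'b \<Rightarrow> int"
  assumes "finite T"
  shows "(\<Prod>x\<in>T. (h(v := - h v)) (g x)) = (-1) ^ card {x \<in> T. g x = v} * (\<Prod>x\<in>T. h (g x))"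
proof -
  have "(\<Prod>x\<in>T. (h(v := - h v)) (g x)) = (\<Prod>x\<in>T. (if g x = v then -1 else 1) * h (g x))"
    by (intro prod.cong) auto
  also have "\<dots> = (\<Prod>x\<in>T. if g x = v then -1 else 1) * (\<Prod>x\<in>T. h (g x))"
    by (rule prod.distrib)
  also have "(\<Prod>x\<in>T. if g x = v then -1 else 1 :: int) = (-1) ^ card {x \<in> T. g x = v}"
    using assms by (simp add: prod.If_cases Int_def)
  finally show ?thesis .
qed

text \<open>Orthogonality of characters on the group of border signs. The summand is the trivial
  character if every row and column meets \<open>T\<close> evenly; otherwise reversing the border
  sign of an odd row or column reverses the summand, and the sum cancels.\<close>

lemma sum_border_signs:
  assumes T: "T \<subseteq> square (n - 1)"
  shows "(\<Sum>w\<in>border n \<rightarrow>\<^sub>E {-1, 1}. \<Prod>p\<in>T. w (fst p, n) * w (n, snd p)) =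
           (if T \<in> cycle_space T then 2 ^ card (border n) else 0 :: int)"
proof (cases "T \<in> cycle_space T")
  case True
  have fin: "finite T"
    using T by (rule finite_subset) simp
  have "(\<Prod>p\<in>T. w (fst p, n) * w (n, snd p)) = 1" if w: "w \<in> border n \<rightarrow>\<^sub>E {-1, 1 :: int}" for w
  proof -
    have "w (fst p, n) \<in> {-1, 1}" "w (n, snd p) \<in> {-1, 1}" if "p \<in> T" for p
      using PiE_mem[OF w] border_cells[of p n] T that by blast+
    then have "(\<Prod>p\<in>T. w (fst p, n)) = 1" "(\<Prod>p\<in>T. w (n, snd p)) = 1"
      using prod_even_multiplicities[OF fin, of "\<lambda>i. w (i, n)" fst]
        prod_even_multiplicities[OF fin, of "\<lambda>j. w (n, j)" snd] True
      by (auto simp: cycle_space_def)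
    then show ?thesis by (simp add: prod.distrib)
  qed
  then show ?thesis
    using True by (simp add: card_PiE)
next
  case False
  have fin: "finite T"
    using T by (rule finite_subset) simp
  have "\<exists>v\<in>border n. \<forall>w. (\<Prod>p\<in>T. (w(v := - w v)) (fst p, n) * (w(v := - w v)) (n, snd p)) =
      - (\<Prod>p\<in>T. w (fst p, n) * w (n, snd p) :: int)"
  proof -
    consider i where "odd (card {p \<in> T. fst p = i})" | j where "odd (card {p \<in> T. snd p = j})"
      using False by (auto simp: cycle_space_def)
    then show ?thesis
    proof cases
      case 1
      then have "{p \<in> T. fst p = i} \<noteq> {}" by (metis card.empty even_zero)
      then obtain p where p: "p \<in> T" "fst p = i" by auto
      \<comment> \<open>Reversing a row sign leaves all column signs alone, since columns of inner
        cells differ from \<open>n\<close>. Only the row factor changes, by the parity of row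
        \<open>i\<close>.\<close>
      have "(\<Prod>p\<in>T. (w((i, n) := - w (i, n))) (n, snd p)) = (\<Prod>p\<in>T. w (n, snd p))" for w :: "nat \<times> nat \<Rightarrow> int"
        by (intro prod.cong refl fun_upd_other border_cells(5)[OF subsetD[OF T]])
      moreover have "{p \<in> T. (fst p, n) = (i, n)} = {p \<in> T. fst p = i}" by auto
      ultimately have "\<forall>w. (\<Prod>p\<in>T. (w((i, n) := - w (i, n))) (fst p, n) * (w((i, n) := - w (i, n))) (n, snd p)) =
      - (\<Prod>p\<in>T. w (fst p, n) * w (n, snd p) :: int)"
        using prod_flip[OF fin, of _ "(i, n)" "\<lambda>p. (fst p, n)"] 1
        by (simp add: prod.distrib del: fun_upd_apply)
      then show ?thesis
        using border_cells[of p n] p T by blast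
    next
      case 2
      then have "{p \<in> T. snd p = j} \<noteq> {}" by (metis card.empty even_zero)
      then obtain p where p: "p \<in> T" "snd p = j" by auto
      have "(\<Prod>p\<in>T. (w((n, j) := - w (n, j))) (fst p, n)) = (\<Prod>p\<in>T. w (fst p, n))" for w :: "nat \<times> nat \<Rightarrow> int"
        by (intro prod.cong refl fun_upd_other border_cells(4)[OF subsetD[OF T]])
      moreover have "{p \<in> T. (n, snd p) = (n, j)} = {p \<in> T. snd p = j}" by auto
      ultimately have "\<forall>w. (\<Prod>p\<in>T. (w((n, j) := - w (n, j))) (fst p, n) * (w((n, j) := - w (n, j))) (n, snd p)) =
      - (\<Prod>p\<in>T. w (fst p, n) * w (n, snd p) :: int)"
        using prod_flip[OF fin, of _ "(n, j)" "\<lambda>p. (n, snd p)"] 2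
        by (simp add: prod.distrib del: fun_upd_apply)
      then show ?thesis
        using border_cells[of p n] p T by blast
    qed
  qed
  then obtain v where v: "v \<in> border n" and flip:
    "\<And>w. (\<Prod>p\<in>T. (w(v := - w v)) (fst p, n) * (w(v := - w v)) (n, snd p)) =
      - (\<Prod>p\<in>T. w (fst p, n) * w (n, snd p) :: int)" by blast
  have "(\<Sum>w\<in>border n \<rightarrow>\<^sub>E {-1, 1 :: int}. \<Prod>p\<in>T. w (fst p, n) * w (n, snd p)) = 0"
  proof (rule sum_sign_reversing_involution[where g = "\<lambda>w. w(v := - w v)"])
    fix w :: "nat \<times> nat \<Rightarrow> int" assume "w \<in> border n \<rightarrow>\<^sub>E {-1, 1}"
    then show "w(v := - w v) \<in> border n \<rightarrow>\<^sub>E {-1, 1}"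
      using v by (auto simp: PiE_def extensional_def Pi_def)
  qed (simp, rule flip)
  then show ?thesis
    using False by simp
qed

text \<open>Fourier expansion of the product of the indicators \<open>(1 + c p * w (fst p, n) * w (n, snd p)) / 2\<close>.\<close>

lemma card_border_signs:
  fixes c :: "nat \<times> nat \<Rightarrow> int"
  assumes S: "S \<subseteq> square (n - 1)" and c: "\<And>p. p \<in> S \<Longrightarrow> c p \<in> {-1, 1}"
  shows "int (card {w \<in> border n \<rightarrow>\<^sub>E {-1, 1}. \<forall>p\<in>S. w (fst p, n) * w (n, snd p) = c p}) * 2 ^ card S =
    2 ^ card (border n) * (\<Sum>T\<in>cycle_space S. \<Prod>p\<in>T. c p)"
proof -
  let ?W = "border n \<rightarrow>\<^sub>E {-1, 1 :: int}"
  let ?e = "\<lambda>w :: nat \<times> nat \<Rightarrow> int. \<lambda>p. w (fst p, n) * w (n, snd p)"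
  have finS: "finite S" using S by (rule finite_subset) simp
  have finW: "finite ?W" by (simp add: finite_PiE)
  have ind: "(\<Prod>p\<in>S. c p * ?e w p + 1) = (if \<forall>p\<in>S. ?e w p = c p then 2 ^ card S else 0)"
    if w: "w \<in> ?W" for w
  proof -
    have fac: "c p * ?e w p + 1 = (if ?e w p = c p then 2 else 0)" if "p \<in> S" for p
    proof -
      have "w (fst p, n) \<in> {-1, 1}" "w (n, snd p) \<in> {-1, 1}"
        using PiE_mem[OF w] border_cells[of p n] S that by blast+
      with c[OF that] show ?thesis by auto
    qed
    show ?thesis
    proof (cases "\<forall>p\<in>S. ?e w p = c p")
      case True
      then show ?thesis using fac by simp
    next
      case False
      then obtain p where "p \<in> S" "?e w p \<noteq> c p" by blast
      with fac have "c p * ?e w p + 1 = 0" by simp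
      with \<open>p \<in> S\<close> finS have "(\<Prod>p\<in>S. c p * ?e w p + 1) = 0"
        by (intro prod_zero) auto
      with False show ?thesis by simp
    qed
  qed
  have "int (card {w \<in> ?W. \<forall>p\<in>S. ?e w p = c p}) * 2 ^ card S =
      (\<Sum>w\<in>?W. if \<forall>p\<in>S. ?e w p = c p then 2 ^ card S else 0)"
    using finW by (simp add: sum.inter_filter[symmetric])
  also have "\<dots> = (\<Sum>w\<in>?W. \<Prod>p\<in>S. c p * ?e w p + 1)"
    using ind by (intro sum.cong) auto
  also have "\<dots> = (\<Sum>w\<in>?W. \<Sum>T\<in>Pow S. (\<Prod>p\<in>T. c p) * (\<Prod>p\<in>T. ?e w p))"
    using finS by (simp add: prod_add prod.distrib)
  also have "\<dots> = (\<Sum>T\<in>Pow S. \<Sum>w\<in>?W. (\<Prod>p\<in>T. c p) * (\<Prod>p\<in>T. ?e w p))"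
    by (rule sum.swap)
  also have "\<dots> = (\<Sum>T\<in>Pow S. (\<Prod>p\<in>T. c p) * (if T \<in> cycle_space T then 2 ^ card (border n) else 0))"
    using S sum_border_signs[of _ n] by (intro sum.cong) (auto simp: sum_distrib_left[symmetric])
  also have "\<dots> = (\<Sum>T\<in>Pow S. if T \<in> cycle_space T then 2 ^ card (border n) * (\<Prod>p\<in>T. c p) else 0)"
    by (intro sum.cong) auto
  also have "\<dots> = (\<Sum>T\<in>{T \<in> Pow S. T \<in> cycle_space T}. 2 ^ card (border n) * (\<Prod>p\<in>T. c p))"
    using finS by (subst sum.inter_filter) auto
  also have "{T \<in> Pow S. T \<in> cycle_space T} = cycle_space S"
    by (auto simp: cycle_space_def)
  finally show ?thesis by (simp add: sum_distrib_left)
qed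

section \<open>Arrays as product sets; sign matrices with prescribed image\<close>

lemma arrays_dom: "B \<in> arrays I \<Longrightarrow> dom B = I"
  by (simp add: arrays_def)

lemma arrays_entry:
  assumes "B \<in> arrays I" "p \<in> I"
  shows "\<exists>b\<in>{-1, 0, 1}. B p = Some b"
proof -
  obtain b where "B p = Some b"
    using assms by (auto simp: arrays_def)
  then show ?thesis
    using assms ranI[of B p b] by (auto simp: arrays_def)
qed

text \<open>As a product set with default value \<open>None\<close>, the set of arrays has
  cardinalities and \<open>Pi_pmf\<close> probabilities that factor over the cells.\<close>

lemma arrays_eq_PiE_dflt: "arrays I = PiE_dflt I None (\<lambda>_. Some ` {-1, 0, 1})"
proof (intro set_eqI iffI)
  fix B assume B: "B \<in> arrays I"
  then have "B p = None" if "p \<notin> I" for p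
    using that by (auto simp: arrays_def)
  moreover have "B p \<in> Some ` {-1, 0, 1}" if "p \<in> I" for p
    using arrays_entry[OF B that] by (elim bexE) (simp only: imageI)
  ultimately show "B \<in> PiE_dflt I None (\<lambda>_. Some ` {-1, 0, 1})"
    unfolding PiE_dflt_def by blast
next
  fix B :: array assume B: "B \<in> PiE_dflt I None (\<lambda>_. Some ` {-1, 0, 1})"
  then have 1: "B p = None" if "p \<notin> I" for p
    using that unfolding PiE_dflt_def by blast
  have 2: "\<exists>b\<in>{-1, 0, 1}. B p = Some b" if "p \<in> I" for p
    using B that unfolding PiE_dflt_def image_iff by blast
  have "dom B = I"
    using 1 2 by (fastforce simp: dom_def)
  moreover have "b \<in> {-1, 0, 1}" if "B p = Some b" for p b
    using 1[of p] 2[of p] that by force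
  ultimately show "B \<in> arrays I"
    unfolding arrays_def ran_def by blast
qed

lemma entry_event_eq_PiE_dflt:
  assumes B: "B \<in> arrays I" and I: "I \<subseteq> square (n - 1)"
  shows "entry_event n B =
    PiE_dflt (square (n - 1)) None (\<lambda>p. if p \<in> I then {B p} else Some ` {-1, 0, 1})"
proof (intro set_eqI)
  fix B' :: array
  have "B' |` I = B \<longleftrightarrow> (\<forall>p\<in>I. B' p = B p)"
    using B by (auto simp: fun_eq_iff restrict_map_def arrays_eq_PiE_dflt PiE_dflt_def)
  then have "B' \<in> entry_event n B \<longleftrightarrow>
      B' \<in> PiE_dflt (square (n - 1)) None (\<lambda>_. Some ` {-1, 0, 1}) \<and> (\<forall>p\<in>I. B' p = B p)"
    unfolding entry_event_def arrays_eq_PiE_dflt[symmetric] using arrays_dom[OF B] by simp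
  moreover have "B' \<in> PiE_dflt Q None (\<lambda>p. if p \<in> I then {B p} else V) \<longleftrightarrow>
      B' \<in> PiE_dflt Q None (\<lambda>_. V) \<and> (\<forall>p\<in>I. B' p = B p)"
    if "I \<subseteq> Q" "\<forall>p\<in>I. B p \<in> V" for Q V
  proof -
    have "(B' p \<in> (if p \<in> I then {B p} else V)) \<longleftrightarrow> B' p \<in> V \<and> (p \<in> I \<longrightarrow> B' p = B p)" for p
      using that(2) by (cases "p \<in> I") auto
    then show ?thesis
      using that(1) unfolding PiE_dflt_def by blast
  qed
  moreover have "\<forall>p\<in>I. B p \<in> Some ` {-1, 0, 1}"
    using arrays_entry[OF B] by blast
  ultimately show "B' \<in> entry_event n B \<longleftrightarrow>
      B' \<in> PiE_dflt (square (n - 1)) None (\<lambda>p. if p \<in> I then {B p} else Some ` {-1, 0, 1})"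
    using I by simp
qed

lemma sign_cells:
  assumes A: "A \<in> square n \<rightarrow>\<^sub>E {-1, 1 :: int}" and p: "p \<in> square (n - 1)"
  shows "A p = -1 \<or> A p = 1" "A (fst p, n) = -1 \<or> A (fst p, n) = 1"
    "A (n, snd p) = -1 \<or> A (n, snd p) = 1" "A (n, n) = -1 \<or> A (n, n) = 1"
proof -
  have sign: "A q = -1 \<or> A q = 1" if "q \<in> square n" for q
    using PiE_mem[OF A that] by blast
  show "A p = -1 \<or> A p = 1" "A (fst p, n) = -1 \<or> A (fst p, n) = 1"
    "A (n, snd p) = -1 \<or> A (n, snd p) = 1" "A (n, n) = -1 \<or> A (n, n) = 1"
    by (rule sign; use p in \<open>auto simp: square_def\<close>)+
qed

lemma half_chio_cell:
  "p \<in> square (n - 1) \<Longrightarrow>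
    half_chio n A p = Some ((A p * A (n, n) - A (fst p, n) * A (n, snd p)) div 2)"
  by (cases p) (simp add: half_chio_def)

text \<open>With c the corner sign and e the product of the two border signs, the entry is (c
  \<open>A p\<close> - e) / 2. It vanishes iff c \<open>A p\<close> = e, and it equals a sign b iff
  c \<open>A p\<close> = b and e = -b.\<close>

lemma half_chio_eq_iff:
  assumes A: "A \<in> square n \<rightarrow>\<^sub>E {-1, 1}" and p: "p \<in> square (n - 1)" and b: "b \<in> {-1, 0, 1}"
  shows "half_chio n A p = Some b \<longleftrightarrow>
    A p = A (n, n) * (if b = 0 then A (fst p, n) * A (n, snd p) else b) \<and>
    (b \<noteq> 0 \<longrightarrow> A (fst p, n) * A (n, snd p) = - b)"
  using b sign_cells[OF A p] unfolding half_chio_cell[OF p] by (elim disjE insertE emptyE; simp)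

text \<open>Sign matrices are fibred over their last row and column. An admissible border determines
  the inner signs on \<open>I\<close> and leaves the other inner signs free, so all fibres have the
  same size.\<close>

lemma card_chio:
  assumes B: "B \<in> arrays I" and I: "I \<subseteq> square (n - 1)"
  shows "card {A \<in> square n \<rightarrow>\<^sub>E {-1, 1}. half_chio n A \<in> entry_event n B} =
    card {w \<in> border n \<rightarrow>\<^sub>E {-1, 1}. \<forall>p\<in>supp B. w (fst p, n) * w (n, snd p) = - the (B p)} *
    2 ^ ((n - 1)\<^sup>2 - card I)"
proof -
  let ?sq = "square (n - 1)"
  define W where "W = {w \<in> border n \<rightarrow>\<^sub>E {-1, 1 :: int}.
      \<forall>p\<in>supp B. w (fst p, n) * w (n, snd p) = - the (B p)}"
  \<comment> \<open>The inner sign forced at a specified cell. It depends on the border only, so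
    \<open>F w\<close> below, forced on \<open>I\<close> and free elsewhere, is the fibre over
    \<open>w\<close>.\<close>
  define g where "g w p = w (n, n) * (if B p = Some 0 then w (fst p, n) * w (n, snd p) else the (B p))"
    for w :: "nat \<times> nat \<Rightarrow> int" and p
  define F where "F w = (\<Pi>\<^sub>E p\<in>?sq. if p \<in> I then {g w p} else {-1, 1})" for w
  define X where "X = {A \<in> square n \<rightarrow>\<^sub>E {-1, 1}. half_chio n A \<in> entry_event n B}"
  have supp: "p \<in> supp B \<longleftrightarrow> p \<in> I \<and> B p \<noteq> Some 0" for p
    using arrays_dom[OF B] by (simp add: supp_def)
  have X_iff: "A \<in> X \<longleftrightarrow> A \<in> square n \<rightarrow>\<^sub>E {-1, 1} \<and>
      (\<forall>p\<in>I. A p = g A p \<and> (p \<in> supp B \<longrightarrow> A (fst p, n) * A (n, snd p) = - the (B p)))" for A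
  proof (cases "A \<in> square n \<rightarrow>\<^sub>E {-1, 1}")
    case True
    \<comment> \<open>The image of a sign matrix automatically has the right domain and entries in
      \<open>{-1, 0, 1}\<close>, so lying in the event means only agreeing with \<open>B\<close> on
      \<open>I\<close>.\<close>
    have signs: "half_chio n A q \<in> Some ` {-1, 0, 1}" if q: "q \<in> ?sq" for q
      using q sign_cells[OF True q] by (elim disjE) (simp_all add: half_chio_cell[OF q])
    moreover have "half_chio n A q = None" if "q \<notin> ?sq" for q
      using that by (simp add: half_chio_def)
    ultimately have "half_chio n A \<in> entry_event n B \<longleftrightarrow> (\<forall>p\<in>I. half_chio n A p = B p)"
      using I by (auto simp: entry_event_eq_PiE_dflt[OF B I] PiE_dflt_def)
    also have "\<dots> \<longleftrightarrow> (\<forall>p\<in>I. A p = g A p \<and> (p \<in> supp B \<longrightarrow> A (fst p, n) * A (n, snd p) = - the (B p)))"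
    proof (rule ball_cong[OF refl])
      fix p assume p: "p \<in> I"
      then obtain b where b: "b \<in> {-1, 0, 1}" "B p = Some b"
        using arrays_entry[OF B] by blast
      have "p \<in> ?sq" using p I by blast
      show "half_chio n A p = B p \<longleftrightarrow>
          A p = g A p \<and> (p \<in> supp B \<longrightarrow> A (fst p, n) * A (n, snd p) = - the (B p))"
        unfolding b(2) half_chio_eq_iff[OF True \<open>p \<in> ?sq\<close> b(1)]
        using p b(2) by (simp add: g_def supp)
    qed
    finally show ?thesis
      using True by (simp add: X_def)
  qed (simp add: X_def)
  have W_g: "g w p \<in> {-1, 1}" if "w \<in> border n \<rightarrow>\<^sub>E {-1, 1}" "p \<in> I" for w p
  proof -
    have "w q = -1 \<or> w q = 1" if "q \<in> border n" for q
      using PiE_mem[OF \<open>w \<in> _\<close> that] by blast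
    moreover have "p \<in> ?sq" using that I by blast
    ultimately have "w (fst p, n) = -1 \<or> w (fst p, n) = 1" "w (n, snd p) = -1 \<or> w (n, snd p) = 1"
        "w (n, n) = -1 \<or> w (n, n) = 1"
      using border_cells by blast+
    moreover obtain b where "b \<in> {-1, 0, 1}" "B p = Some b"
      using arrays_entry[OF B] \<open>p \<in> I\<close> by blast
    ultimately show ?thesis
      by (auto simp: g_def)
  qed
  have disj: "p \<notin> border n" if "p \<in> ?sq" for p
    using that by (simp add: border_def)
  have in_border: "(fst p, n) \<in> border n" "(n, snd p) \<in> border n" "(n, n) \<in> border n"
    if "p \<in> I" for p
    using border_cells(1-3)[of p n] that I by blast+
  \<comment> \<open>\<open>split\<close> and \<open>glue\<close> are mutually inverse because border
    and inner square partition the square; outside it both sides are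
    \<open>undefined\<close>.\<close>
  define glue where "glue = (\<lambda>(w, a) x. if x \<in> border n then w x else a x :: int)"
  define split where "split A = (restrict A (border n), restrict A ?sq)" for A :: "nat \<times> nat \<Rightarrow> int"
  have "bij_betw split X (Sigma W F)"
  proof (rule bij_betw_byWitness[where f' = glue])
    show "\<forall>A\<in>X. glue (split A) = A"
    proof
      fix A assume "A \<in> X"
      then have "A \<in> extensional (square n)" by (simp add: X_def PiE_def)
      then have "A x = undefined" if "x \<notin> border n" "x \<notin> ?sq" for x
        using that square_border[of n] by (simp add: extensional_def)
      then show "glue (split A) = A"
        by (intro ext) (simp add: glue_def split_def restrict_def)
    qed
    show "\<forall>x\<in>Sigma W F. split (glue x) = x"
    proof
      fix x assume "x \<in> Sigma W F"
      then obtain w a where x: "x = (w, a)" "w \<in> W" "a \<in> F w" by blast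
      then have "w \<in> extensional (border n)" "a \<in> extensional ?sq"
        by (simp_all add: W_def F_def PiE_def)
      then have "restrict (glue x) (border n) = w" "restrict (glue x) ?sq = a"
        using disj by (intro ext; simp add: x(1) glue_def restrict_def extensional_def)+
      then show "split (glue x) = x"
        by (simp add: split_def x(1))
    qed
    show "split ` X \<subseteq> Sigma W F"
    proof (rule image_subsetI)
      fix A assume A: "A \<in> X"
      have "restrict A (border n) \<in> W"
        using A square_border[of n] in_border
        unfolding W_def X_iff by (simp add: supp PiE_iff)
      moreover have "g (restrict A (border n)) p = g A p" if "p \<in> I" for p
        using in_border[OF that] by (simp add: g_def)
      then have "restrict A ?sq \<in> F (restrict A (border n))"
        using A square_border[of n] unfolding F_def X_iff by (auto simp: PiE_iff)
      ultimately show "split A \<in> Sigma W F"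
        by (simp add: split_def)
    qed
    show "glue ` Sigma W F \<subseteq> X"
    proof (rule image_subsetI)
      fix x assume "x \<in> Sigma W F"
      then obtain w a where x: "x = (w, a)" "w \<in> W" "a \<in> F w" by blast
      have w: "w \<in> border n \<rightarrow>\<^sub>E {-1, 1}" using x(2) by (simp add: W_def)
      have mem: "a p \<in> (if p \<in> I then {g w p} else {-1, 1})" if "p \<in> ?sq" for p
        using x(3) that unfolding F_def by (rule PiE_mem)
      then have a: "a p = g w p" if "p \<in> I" for p
        using mem[of p] that I by (simp add: subsetD)
      have "a p \<in> {-1, 1}" if "p \<in> ?sq" for p
        using mem[OF that] W_g[OF w, of p] by (cases "p \<in> I") simp_all
      moreover have "w p \<in> {-1, 1}" if "p \<in> border n" for p
        using w that by (rule PiE_mem)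
      moreover have "a p = undefined" if "p \<notin> ?sq" for p
        using x(3) that unfolding F_def by (rule PiE_arb)
      ultimately have "glue x \<in> square n \<rightarrow>\<^sub>E {-1, 1}"
        unfolding square_border[of n] by (intro PiE_I) (simp_all add: x(1) glue_def, blast)
      moreover have "g (glue x) p = g w p" if "p \<in> I" for p
        using in_border[OF that] by (simp add: g_def x(1) glue_def)
      moreover have "glue x p = a p" if "p \<in> I" for p
        using disj[of p] that I by (simp add: x(1) glue_def subsetD)
      moreover have "glue x (fst p, n) * glue x (n, snd p) = - the (B p)" if "p \<in> supp B" for p
        using x(2) that in_border[of p] supp[of p] by (simp add: W_def x(1) glue_def)
      ultimately show "glue x \<in> X"
        using a unfolding X_iff by simp
    qed
  qed
  then have "card X = card (Sigma W F)"
    by (rule bij_betw_same_card)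
  moreover have "card (F w) = 2 ^ ((n - 1)\<^sup>2 - card I)" for w
  proof -
    have "card (F w) = (\<Prod>p\<in>?sq. if p \<in> I then 1 else 2)"
      unfolding F_def by (subst card_PiE) (auto intro!: prod.cong)
    also have "\<dots> = 2 ^ card (?sq - I)"
      by (subst prod.If_cases) (simp_all add: Diff_eq)
    also have "card (?sq - I) = (n - 1)\<^sup>2 - card I"
      using I by (simp add: card_Diff_subset finite_subset)
    finally show ?thesis .
  qed
  moreover have "card (Sigma W F) = (\<Sum>w\<in>W. card (F w))"
    by (rule card_SigmaI) (auto simp: W_def F_def finite_PiE)
  ultimately have "card X = card W * 2 ^ ((n - 1)\<^sup>2 - card I)"
    by simp
  then show ?thesis
    unfolding X_def W_def .
qed

lemma P_chio_entry_event:
  assumes B: "B \<in> arrays I" and I: "I \<subseteq> square (n - 1)" and n: "n \<ge> 1"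
  shows "P_chio n (entry_event n B) = real_of_int (chio_ratio B) * (1 / 2) ^ (card I + card (supp B))"
proof -
  let ?N = "card {w \<in> border n \<rightarrow>\<^sub>E {-1, 1}. \<forall>p\<in>supp B. w (fst p, n) * w (n, snd p) = - the (B p)}"
  have "supp B \<subseteq> square (n - 1)"
    using I arrays_dom[OF B] by (auto simp: supp_def)
  moreover have "- the (B p) \<in> {-1, 1}" if "p \<in> supp B" for p
    using that arrays_entry[OF B, of p] arrays_dom[OF B] by (auto simp: supp_def)
  ultimately have "int ?N * 2 ^ card (supp B) = 2 ^ card (border n) * chio_ratio B"
    unfolding chio_ratio_def by (rule card_border_signs)
  then have "real_of_int (int ?N * 2 ^ card (supp B)) = real_of_int (2 ^ card (border n) * chio_ratio B)"
    by (simp only:)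
  then have N: "real ?N * 2 ^ card (supp B) = 2 ^ card (border n) * real_of_int (chio_ratio B)"
    by simp
  have "card I \<le> (n - 1)\<^sup>2"
    using card_mono[OF _ I] by simp
  \<comment> \<open>The cells split into border, unspecified inner and specified inner cells. The
    first two powers of 2 cancel against the count, and the third remains as the factor for
    \<open>card I\<close>.\<close>
  then have "n\<^sup>2 = card (border n) + ((n - 1)\<^sup>2 - card I) + card I"
    using card_border[OF n] by simp
  then have "(2 :: real) ^ (n\<^sup>2) = 2 ^ card (border n) * 2 ^ ((n - 1)\<^sup>2 - card I) * 2 ^ card I"
    by (metis power_add)
  then show ?thesis
    using N unfolding P_chio_def card_chio[OF B I]
    by (simp add: field_simps power_add)
qed

section \<open>Lazy coin probabilities of entry events\<close>

lemma prob_lazy_coin: "measure_pmf.prob lazy_coin {b} = pmf lazy_coin b"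
  by (simp add: pmf.rep_eq)

text \<open>Unspecified cells contribute 1 to the product. A specified cell contributes 1/2, and a
  nonzero value there a second factor 1/2, since 1/4 = 1/2 * 1/2.\<close>

lemma P_lcf_entry_event:
  assumes B: "B \<in> arrays I" and I: "I \<subseteq> square (n - 1)"
  shows "P_lcf n (entry_event n B) = (1 / 2) ^ (card I + card (supp B))"
proof -
  let ?sq = "square (n - 1)"
  have fin: "finite I" using I by (rule finite_subset) simp
  let ?q = "\<lambda>p. measure_pmf.prob (map_pmf Some lazy_coin) (if p \<in> I then {B p} else Some ` {-1, 0, 1})"
  have vim: "Some -` (Some ` C) = C" for C :: "int set" by auto
  have one: "measure_pmf.prob lazy_coin {-1, 0, 1} = 1"
    by (simp add: measure_measure_pmf_finite pmf_lazy_coin)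
  have unspecified: "?q p = 1" if "p \<notin> I" for p
    using that by (simp only: if_False measure_map_pmf vim one)
  have "P_lcf n (entry_event n B) = (\<Prod>p\<in>?sq. ?q p)"
    unfolding P_lcf_def lcf_pmf_def entry_event_eq_PiE_dflt[OF B I]
    by (rule measure_Pi_pmf_PiE_dflt) simp
  also have "\<dots> = (\<Prod>p\<in>I. ?q p)"
    using I unspecified by (intro prod.mono_neutral_right) blast+
  also have "\<dots> = (\<Prod>p\<in>I. 1 / 2 * (if p \<in> supp B then 1 / 2 else 1))"
  proof (rule prod.cong[OF refl])
    fix p assume p: "p \<in> I"
    then obtain b where b: "b \<in> {-1, 0, 1}" "B p = Some b"
      using arrays_entry[OF B] by blast
    have "Some -` {Some b} = {b}" by auto
    then show "?q p = 1 / 2 * (if p \<in> supp B then 1 / 2 else 1)"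
      using p b by (auto simp: supp_def measure_map_pmf prob_lazy_coin pmf_lazy_coin)
  qed
  also have "\<dots> = (1 / 2) ^ card I * (1 / 2) ^ card (I \<inter> supp B)"
    using fin by (subst prod.distrib) (simp add: prod.If_cases Int_def)
  also have "I \<inter> supp B = supp B"
    using arrays_dom[OF B] by (auto simp: supp_def)
  finally show ?thesis by (simp add: power_add)
qed

section \<open>Structure of small cycle spaces\<close>

lemma finite_cycle_space: "finite S \<Longrightarrow> finite (cycle_space S)"
  by (rule finite_subset[of _ "Pow S"]) (auto simp: cycle_space_def)

lemma cycle_space_subset: "T \<in> cycle_space S \<Longrightarrow> T \<subseteq> S"
  by (simp add: cycle_space_def)

lemma empty_in_cycle_space: "{} \<in> cycle_space S"
  by (simp add: cycle_space_def)

lemma even_card_sym_diff: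
  assumes "finite A" "finite B" "even (card A)" "even (card B)"
  shows "even (card (sym_diff A B))"
proof -
  have "card A = card (A \<inter> B) + card (A - B)" "card B = card (A \<inter> B) + card (B - A)"
    using card_Int_Diff[OF assms(1), of B] card_Int_Diff[OF assms(2), of A] by (simp_all add: Int_commute)
  moreover have "card (sym_diff A B) = card (A - B) + card (B - A)"
    using assms(1,2) by (intro card_Un_disjoint) auto
  ultimately show ?thesis
    using assms(3,4) by presburger
qed

text \<open>Symmetric difference is the addition of the cycle space: the parity of the number of
  cells in a row or column is additive.\<close>

lemma sym_diff_in_cycle_space:
  assumes "finite S" "T \<in> cycle_space S" "U \<in> cycle_space S"
  shows "sym_diff T U \<in> cycle_space S"
proof -
  have fin: "finite T" "finite U"
    using assms finite_subset cycle_space_subset by blast+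
  have "{p \<in> sym_diff T U. P p} = sym_diff {p \<in> T. P p} {p \<in> U. P p}" for P
    by auto
  then have *: "even (card {p \<in> sym_diff T U. P p})"
    if "even (card {p \<in> T. P p})" "even (card {p \<in> U. P p})" for P
    using that fin by (simp add: even_card_sym_diff)
  show ?thesis
    unfolding cycle_space_def
  proof (intro CollectI conjI allI)
    show "sym_diff T U \<subseteq> S"
      using assms(2,3) by (auto dest: cycle_space_subset)
    show "even (card {p \<in> sym_diff T U. fst p = i})" "even (card {p \<in> sym_diff T U. snd p = j})" for i j
      by (rule *; use assms(2,3) in \<open>simp add: cycle_space_def\<close>)+
  qed
qed

text \<open>The common cells occur in both factors on the right, where their signs square to 1. This
  is the multiplicativity of the character behind \<open>chio_ratio\<close>.\<close>

lemma prod_sym_diff: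
  fixes c :: "'a \<Rightarrow> int"
  assumes "finite T" "finite U" "\<And>x. x \<in> T \<union> U \<Longrightarrow> c x \<in> {-1, 1}"
  shows "prod c (sym_diff T U) = prod c T * prod c U"
proof -
  have "prod c T = prod c (T \<inter> U) * prod c (T - U)" "prod c U = prod c (T \<inter> U) * prod c (U - T)"
    using prod.Int_Diff[OF assms(1), of c U] prod.Int_Diff[OF assms(2), of c T] by (simp_all add: Int_commute)
  moreover have "prod c (T \<inter> U) * prod c (T \<inter> U) = 1"
    unfolding prod.distrib[symmetric]
  proof (rule prod.neutral, rule ballI)
    show "c x * c x = 1" if "x \<in> T \<inter> U" for x
      using assms(3)[of x] that by auto
  qed
  moreover have "prod c (sym_diff T U) = prod c (T - U) * prod c (U - T)"
    using assms(1,2) by (intro prod.union_disjoint) auto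
  ultimately show ?thesis
    using mult.assoc[of "prod c (T \<inter> U)" "prod c (T \<inter> U)" "prod c (T - U) * prod c (U - T)"]
    by (simp add: mult.left_commute mult.assoc)
qed

lemma prod_signs:
  fixes c :: "'a \<Rightarrow> int"
  assumes "\<And>x. x \<in> T \<Longrightarrow> c x \<in> {-1, 1}"
  shows "prod c T \<in> {-1, 1}"
  using assms
proof (induction T rule: infinite_finite_induct)
  case (insert x T)
  then have "prod c T \<in> {-1, 1}" "c x \<in> {-1, 1}" by blast+
  then show ?case
    unfolding prod.insert[OF insert.hyps] by (elim insertE emptyE) simp_all
qed simp_all

text \<open>Adding a cycle of sign \<open>-1\<close> is a sign-reversing involution of the cycle space.\<close>

lemma sum_cycle_space:
  fixes c :: "'a \<times> 'b \<Rightarrow> int"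
  assumes S: "finite S" and c: "\<And>p. p \<in> S \<Longrightarrow> c p \<in> {-1, 1}"
  shows "(\<Sum>T\<in>cycle_space S. prod c T) \<in> {0, int (card (cycle_space S))}"
proof (cases "\<forall>T\<in>cycle_space S. prod c T = 1")
  case True
  then show ?thesis by simp
next
  case False
  then obtain U where U: "U \<in> cycle_space S" "prod c U \<noteq> 1" by blast
  have "prod c U \<in> {-1, 1}"
    using c cycle_space_subset[OF U(1)] by (intro prod_signs) blast
  with U(2) have "prod c U = -1" by simp
  have "prod c (sym_diff T U) = - prod c T" if "T \<in> cycle_space S" for T
  proof -
    have "T \<subseteq> S" "U \<subseteq> S" using that U(1) by (auto dest: cycle_space_subset)
    then show ?thesis
      using c S \<open>prod c U = -1\<close> by (subst prod_sym_diff) (auto intro: finite_subset)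
  qed
  then have "(\<Sum>T\<in>cycle_space S. prod c T) = 0"
    using sym_diff_in_cycle_space[OF S _ U(1)]
    by (intro sum_sign_reversing_involution[where g = "\<lambda>T. sym_diff T U"]) auto
  then show ?thesis by simp
qed

section \<open>Cycles of length four and six\<close>

lemma card_eq_sum_fibres: "finite T \<Longrightarrow> card T = (\<Sum>i\<in>f ` T. card {x \<in> T. f x = i})"
  using sum.image_gen[of T "\<lambda>_. 1 :: nat" f] by simp

lemma even_fibre_ge_2:
  assumes "finite T" "\<And>i. even (card {x \<in> T. f x = i})" "i \<in> f ` T"
  shows "card {x \<in> T. f x = i} \<ge> 2"
proof -
  have "card {x \<in> T. f x = i} \<noteq> 0" using assms(1,3) by auto
  with assms(2)[of i] show ?thesis by presburger
qed

lemma twice_card_image_le: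
  assumes "finite T" "\<And>i. even (card {x \<in> T. f x = i})"
  shows "2 * card (f ` T) \<le> card T"
proof -
  have "(\<Sum>i\<in>f ` T. 2) \<le> (\<Sum>i\<in>f ` T. card {x \<in> T. f x = i})"
    by (intro sum_mono even_fibre_ge_2 assms)
  then show ?thesis
    using card_eq_sum_fibres[OF assms(1), of f] by simp
qed

text \<open>A row or column that is met is met at least twice, which gives the first two bounds; the
  third is containment in the box spanned by the rows and columns met.\<close>

lemma cycle_space_bounds:
  assumes "T \<in> cycle_space S" "finite T"
  shows "2 * card (fst ` T) \<le> card T" "2 * card (snd ` T) \<le> card T"
    "card T \<le> card (fst ` T) * card (snd ` T)"
proof -
  show "2 * card (fst ` T) \<le> card T" "2 * card (snd ` T) \<le> card T"
    using assms by (auto intro!: twice_card_image_le simp: cycle_space_def)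
  show "card T \<le> card (fst ` T) * card (snd ` T)"
    unfolding card_cartesian_product[symmetric]
    using assms(2) subset_fst_snd[of T] by (intro card_mono) auto
qed

lemma nat_le_3_cases: "(a :: nat) \<le> 3 \<Longrightarrow> a = 0 \<or> a = 1 \<or> a = 2 \<or> a = 3"
  by auto

text \<open>The bounds alone decide. Five cells would meet at most two rows and two columns and thus
  number at most four; two or three cells would meet at most one row and one column and thus be a
  single cell; one cell could meet no row at all.\<close>

lemma cycle_space_card:
  assumes T: "T \<in> cycle_space S" "finite T" and "T \<noteq> {}" "card T \<le> 6"
  shows "card T = 4 \<or> card T = 6"
proof -
  have "card T \<noteq> 0" using assms(2,3) by simp
  moreover have "card (fst ` T) \<le> 3" "card (snd ` T) \<le> 3"
    using cycle_space_bounds[OF T] assms(4) by linarith+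
  ultimately show ?thesis
    using cycle_space_bounds[OF T] assms(4)
      nat_le_3_cases[OF \<open>card (fst ` T) \<le> 3\<close>] nat_le_3_cases[OF \<open>card (snd ` T) \<le> 3\<close>] by (elim disjE; simp)
qed

lemma cycle_space_4:
  assumes T: "T \<in> cycle_space S" and 4: "card T = 4"
  shows "T = fst ` T \<times> snd ` T" "card (fst ` T) = 2" "card (snd ` T) = 2"
proof -
  have fin: "finite T" using 4 by (metis card.infinite zero_neq_numeral)
  have "card (fst ` T) \<le> 2" "card (snd ` T) \<le> 2" "card (fst ` T) * card (snd ` T) \<ge> 4"
    using cycle_space_bounds[OF T fin] 4 by linarith+
  moreover from this have "card (fst ` T) * card (snd ` T) \<le> 2 * card (snd ` T)"
    "card (fst ` T) * card (snd ` T) \<le> card (fst ` T) * 2"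
    by (auto intro: mult_le_mono)
  ultimately show *: "card (fst ` T) = 2" "card (snd ` T) = 2"
    by linarith+
  show "T = fst ` T \<times> snd ` T"
    using fin * 4 subset_fst_snd[of T] by (intro card_subset_eq) (auto simp: card_cartesian_product)
qed

lemma fst_fibre_Times: "{p \<in> R \<times> C. fst p = i} = (if i \<in> R then {i} \<times> C else {})"
  by auto

lemma snd_fibre_Times: "{p \<in> R \<times> C. snd p = j} = (if j \<in> C then R \<times> {j} else {})"
  by auto

lemma Times_in_cycle_space:
  assumes "R \<times> C \<subseteq> S" "even (card R)" "even (card C)"
  shows "R \<times> C \<in> cycle_space S"
proof -
  have "even (card {p \<in> R \<times> C. fst p = i})" "even (card {p \<in> R \<times> C. snd p = j})" for i j
    using assms(2,3) unfolding fst_fibre_Times snd_fibre_Times by (simp_all add: card_cartesian_product)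
  then show ?thesis
    using assms(1) by (simp add: cycle_space_def)
qed

text \<open>The equality case of \<open>twice_card_image_le\<close>: all fibres have at least two
  elements, and the total leaves no excess.\<close>

lemma fibres_eq_2:
  assumes "finite T" "\<And>i. even (card {x \<in> T. f x = i})" "card T = 2 * card (f ` T)" "i \<in> f ` T"
  shows "card {x \<in> T. f x = i} = 2"
proof -
  note ge = even_fibre_ge_2[OF assms(1,2)]
  have "(\<Sum>i\<in>f ` T. card {x \<in> T. f x = i}) = (\<Sum>i\<in>f ` T. 2)"
    using card_eq_sum_fibres[OF assms(1), of f] assms(3) by simp
  then have "(\<Sum>i\<in>f ` T. card {x \<in> T. f x = i} - 2) = 0"
    using ge by (subst sum_subtractf_nat) auto
  then have "card {x \<in> T. f x = i} - 2 = 0"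
    using assms(4) unfolding sum_eq_0_iff[OF finite_imageI[OF assms(1)]] by (rule bspec)
  with ge[OF assms(4)] show ?thesis by simp
qed

text \<open>At most three rows and three columns with at least six positions leave the shapes 2 x 3,
  3 x 2 and 3 x 3. In the first two the cycle would fill the box, and then some line would have
  three cells, against parity.\<close>

lemma cycle_space_6:
  assumes T: "T \<in> cycle_space S" and 6: "card T = 6"
  shows "card (fst ` T) = 3" "card (snd ` T) = 3"
    "i \<in> fst ` T \<Longrightarrow> card {p \<in> T. fst p = i} = 2"
    "j \<in> snd ` T \<Longrightarrow> card {p \<in> T. snd p = j} = 2"
proof -
  have fin: "finite T" using 6 by (metis card.infinite zero_neq_numeral)
  let ?a = "card (fst ` T)" and ?b = "card (snd ` T)"
  have le: "?a \<le> 3" "?b \<le> 3" "?a * ?b \<ge> 6"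
    using cycle_space_bounds[OF T fin] 6 by linarith+
  have full: "T = fst ` T \<times> snd ` T" if "?a * ?b = 6"
    using fin that 6 subset_fst_snd[of T] by (intro card_subset_eq) (auto simp: card_cartesian_product)
  have "T \<noteq> {}" using 6 by auto
  then obtain p where p: "p \<in> T" by blast
  have even: "even (card {q \<in> T. fst q = fst p})" "even (card {q \<in> T. snd q = snd p})"
    using T by (auto simp: cycle_space_def)
  have evens: "even ?a" "even ?b" if "?a * ?b = 6"
  proof -
    have "{q \<in> T. fst q = fst p} = {fst p} \<times> snd ` T" "{q \<in> T. snd q = snd p} = fst ` T \<times> {snd p}"
      using p fst_fibre_Times[of "fst ` T" "snd ` T" "fst p"]
        snd_fibre_Times[of "fst ` T" "snd ` T" "snd p"] full[OF that] by simp_all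
    with even show "even ?a" "even ?b" by (simp_all add: card_cartesian_product)
  qed
  have "?a = 3 \<and> ?b = 3"
    using le evens nat_le_3_cases[OF le(1)] nat_le_3_cases[OF le(2)] by (elim disjE; simp)
  then show 3: "?a = 3" "?b = 3" by simp_all
  show "i \<in> fst ` T \<Longrightarrow> card {p \<in> T. fst p = i} = 2"
    using T 3 6 fin by (intro fibres_eq_2) (auto simp: cycle_space_def)
  show "j \<in> snd ` T \<Longrightarrow> card {p \<in> T. snd p = j} = 2"
    using T 3 6 fin by (intro fibres_eq_2) (auto simp: cycle_space_def)
qed

text \<open>For bijective \<open>f\<close> between three rows and three columns, a cycle of length six.\<close>

definition hexagon :: "'a set \<Rightarrow> 'b set \<Rightarrow> ('a \<Rightarrow> 'b) \<Rightarrow> ('a \<times> 'b) set" where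
  "hexagon R C f = (SIGMA i:R. C - {f i})"

text \<open>Functions are extensional so that a hexagon determines its \<open>f\<close>; between
  sets of three elements injectivity already means bijectivity.\<close>

definition hexagon_data :: "'a set \<Rightarrow> 'b set \<Rightarrow> ('a \<Rightarrow> 'b) set" where
  "hexagon_data R C = {f \<in> R \<rightarrow>\<^sub>E C. inj_on f R}"

lemma finite_card_3: "card R = 3 \<Longrightarrow> finite R" and finite_card_2: "card R = 2 \<Longrightarrow> finite R"
  by (auto intro: card_ge_0_finite)

lemma hexagon_props:
  assumes R: "card R = 3" and C: "card C = 3" and f: "f \<in> hexagon_data R C"
  shows "card (hexagon R C f) = 6" "fst ` hexagon R C f = R" "snd ` hexagon R C f = C"
    "hexagon R C f \<in> cycle_space (R \<times> C)"
proof -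
  have fin: "finite R" "finite C" using R C by (simp_all add: finite_card_3)
  have fC: "f i \<in> C" if "i \<in> R" for i
    using f that by (auto simp: hexagon_data_def)
  have inj: "inj_on f R"
    using f by (simp add: hexagon_data_def)
  have surj: "f ` R = C"
    using fC fin R C by (intro card_subset_eq) (auto simp: card_image[OF inj])
  have row: "card (C - {f i}) = 2" if "i \<in> R" for i
    using C fin fC[OF that] by simp
  have col: "card {i \<in> R. f i \<noteq> j} = 2" if "j \<in> C" for j
  proof -
    obtain i where i: "i \<in> R" "f i = j" using surj \<open>j \<in> C\<close> by blast
    then have "{i \<in> R. f i \<noteq> j} = R - {i}" using inj by (auto dest: inj_onD)
    then show ?thesis using i R fin by simp
  qed
  show "card (hexagon R C f) = 6"
    using fin row R by (simp add: hexagon_def)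
  have "C - {f i} \<noteq> {}" if "i \<in> R" for i
    using row[OF that] by (metis card.empty zero_neq_numeral)
  then show "fst ` hexagon R C f = R"
    by (force simp: hexagon_def)
  have "{i \<in> R. f i \<noteq> j} \<noteq> {}" if "j \<in> C" for j
    using col[OF that] by (metis card.empty zero_neq_numeral)
  then show "snd ` hexagon R C f = C"
    by (force simp: hexagon_def)
  have "{p \<in> hexagon R C f. fst p = i} = (if i \<in> R then {i} \<times> (C - {f i}) else {})"
    "{p \<in> hexagon R C f. snd p = j} = (if j \<in> C then {i \<in> R. f i \<noteq> j} \<times> {j} else {})" for i j
    by (auto simp: hexagon_def)
  then have "even (card {p \<in> hexagon R C f. fst p = i})" "even (card {p \<in> hexagon R C f. snd p = j})" for i j
    using row[of i] col[of j] by (simp_all add: card_cartesian_product)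
  then show "hexagon R C f \<in> cycle_space (R \<times> C)"
    by (auto simp: cycle_space_def hexagon_def)
qed

text \<open>Each of the three rows has two cells, hence misses exactly one column, and
  \<open>f\<close> names it. If two rows missed the same column, that column would keep at most one
  cell instead of two.\<close>

lemma cycle_space_6_hexagon:
  assumes T: "T \<in> cycle_space S" and 6: "card T = 6"
  shows "\<exists>f\<in>hexagon_data (fst ` T) (snd ` T). T = hexagon (fst ` T) (snd ` T) f"
proof -
  define R C where "R = fst ` T" and "C = snd ` T"
  note c6 = cycle_space_6[OF T 6, folded R_def C_def]
  have fin: "finite R" "finite C" using c6(1,2) by (simp_all add: finite_card_3)
  have TRC: "T \<subseteq> R \<times> C" unfolding R_def C_def by (rule subset_fst_snd)
  have "\<exists>c. C - {j. (i, j) \<in> T} = {c}" if "i \<in> R" for i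
  proof -
    have "{p \<in> T. fst p = i} = {i} \<times> {j. (i, j) \<in> T}" by auto
    then have "card {j. (i, j) \<in> T} = 2"
      using c6(3)[OF that] by (simp add: card_cartesian_product)
    moreover have "{j. (i, j) \<in> T} \<subseteq> C" using TRC by auto
    ultimately have "card (C - {j. (i, j) \<in> T}) = 1"
      using c6(2) fin by (subst card_Diff_subset) (auto intro: finite_subset)
    then show ?thesis by (simp add: card_1_singleton_iff)
  qed
  then obtain g where g: "\<And>i. i \<in> R \<Longrightarrow> C - {j. (i, j) \<in> T} = {g i}" by metis
  define f where "f = restrict g R"
  have f_iff: "(i, j) \<in> T \<longleftrightarrow> j \<noteq> f i" if "i \<in> R" "j \<in> C" for i j
    using g[OF that(1)] that by (auto simp: f_def)
  have fC: "f i \<in> C" if "i \<in> R" for i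
    using g[OF that] that by (auto simp: f_def)
  have "T = hexagon R C f"
    using f_iff TRC by (auto simp: hexagon_def)
  moreover have "inj_on f R"
  proof (rule inj_onI, rule ccontr)
    fix i i' assume i: "i \<in> R" "i' \<in> R" "f i = f i'" "i \<noteq> i'"
    have "{p \<in> T. snd p = f i} \<subseteq> (R - {i, i'}) \<times> {f i}"
      using f_iff i fC[OF i(1)] TRC by auto
    then have "card {p \<in> T. snd p = f i} \<le> card ((R - {i, i'}) \<times> {f i})"
      using fin by (intro card_mono) auto
    also have "\<dots> = 1"
      using i fin c6(1) by (simp add: card_cartesian_product)
    finally show False
      using c6(4)[OF fC[OF i(1)]] by simp
  qed
  moreover have "f \<in> R \<rightarrow>\<^sub>E C"
    using fC by (auto simp: f_def)
  ultimately show ?thesis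
    unfolding R_def[symmetric] C_def[symmetric] hexagon_data_def by blast
qed

section \<open>Numbers of boxes and hexagons\<close>

definition boxes :: "'a set \<Rightarrow> 'b set \<Rightarrow> nat \<Rightarrow> nat \<Rightarrow> ('a \<times> 'b) set set" where
  "boxes X Y a b = (\<lambda>(R, C). R \<times> C) ` ({R. R \<subseteq> X \<and> card R = a} \<times> {C. C \<subseteq> Y \<and> card C = b})"

lemma mem_boxes_iff:
  "T \<in> boxes X Y a b \<longleftrightarrow> (\<exists>R C. R \<subseteq> X \<and> C \<subseteq> Y \<and> card R = a \<and> card C = b \<and> T = R \<times> C)"
  by (auto simp: boxes_def image_iff)

text \<open>Positive side lengths make both factors nonempty, so that a box determines its rows and
  columns; an empty product would not.\<close>

lemma card_boxes:
  assumes "finite X" "finite Y" "a > 0" "b > 0"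
  shows "card (boxes X Y a b) = (card X choose a) * (card Y choose b)"
proof -
  let ?D = "{R. R \<subseteq> X \<and> card R = a} \<times> {C. C \<subseteq> Y \<and> card C = b}"
  have "inj_on (\<lambda>(R, C). R \<times> C) ?D"
  proof (rule inj_onI)
    fix x y assume "x \<in> ?D" "y \<in> ?D" and eq: "(\<lambda>(R, C). R \<times> C) x = (\<lambda>(R, C). R \<times> C) y"
    then have "card (fst x) > 0" "card (snd x) > 0" using assms(3,4) by auto
    then have "fst x \<noteq> {}" "snd x \<noteq> {}" by auto
    then show "x = y" using eq by (auto simp: case_prod_unfold times_eq_iff prod_eq_iff)
  qed
  then show ?thesis
    using assms(1,2) by (simp add: boxes_def card_image card_cartesian_product n_subsets)
qed

lemma card_4_cycles:
  assumes "finite X" "finite Y"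
  shows "card {T \<in> cycle_space (X \<times> Y). card T = 4} = (card X choose 2) * (card Y choose 2)"
proof -
  have "{T \<in> cycle_space (X \<times> Y). card T = 4} = boxes X Y 2 2"
  proof (intro equalityI subsetI)
    fix T assume "T \<in> {T \<in> cycle_space (X \<times> Y). card T = 4}"
    then have T: "T \<in> cycle_space (X \<times> Y)" "card T = 4" by auto
    have "fst ` T \<subseteq> X" "snd ` T \<subseteq> Y"
      using cycle_space_subset[OF T(1)] by auto
    then show "T \<in> boxes X Y 2 2"
      using cycle_space_4[OF T] unfolding mem_boxes_iff by blast
  next
    fix T assume "T \<in> boxes X Y 2 2"
    then show "T \<in> {T \<in> cycle_space (X \<times> Y). card T = 4}"
      by (auto intro!: Times_in_cycle_space simp: mem_boxes_iff card_cartesian_product)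
  qed
  then show ?thesis
    using assms by (simp add: card_boxes)
qed

lemma card_hexagon_data:
  assumes "card R = 3" "card C = 3"
  shows "card (hexagon_data R C) = 6"
  using card_inj_on_subset_funcset[of R C R] assms
  by (simp add: hexagon_data_def finite_card_3 numeral_3_eq_3 atLeastLessThanSuc)

text \<open>A hexagon is the complete bipartite graph on three rows and three columns with a perfect
  matching removed; the factor 6 is the number 3! of matchings.\<close>

lemma card_6_cycles:
  assumes "finite X" "finite Y"
  shows "card {T \<in> cycle_space (X \<times> Y). card T = 6} = 6 * (card X choose 3) * (card Y choose 3)"
proof -
  let ?P = "{R. R \<subseteq> X \<and> card R = 3} \<times> {C. C \<subseteq> Y \<and> card C = 3}"
  let ?D = "SIGMA x:?P. hexagon_data (fst x) (snd x)"
  let ?h = "\<lambda>(x, f). hexagon (fst x) (snd x) f"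
  have "{T \<in> cycle_space (X \<times> Y). card T = 6} = ?h ` ?D"
  proof (intro equalityI subsetI)
    fix T assume "T \<in> {T \<in> cycle_space (X \<times> Y). card T = 6}"
    then have T: "T \<in> cycle_space (X \<times> Y)" "card T = 6" by auto
    have "fst ` T \<subseteq> X" "snd ` T \<subseteq> Y"
      using cycle_space_subset[OF T(1)] by auto
    then have *: "(fst ` T, snd ` T) \<in> ?P"
      using cycle_space_6[OF T] by simp
    obtain f where "f \<in> hexagon_data (fst ` T) (snd ` T)" "T = hexagon (fst ` T) (snd ` T) f"
      using cycle_space_6_hexagon[OF T] by blast
    then show "T \<in> ?h ` ?D"
      using * by (intro image_eqI[of _ _ "((fst ` T, snd ` T), f)"]) auto
  next
    fix T assume "T \<in> ?h ` ?D"
    then obtain R C f where RC: "R \<subseteq> X" "C \<subseteq> Y" "card R = 3" "card C = 3"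
      "f \<in> hexagon_data R C" "T = hexagon R C f" by auto
    moreover have "R \<times> C \<subseteq> X \<times> Y" using RC by blast
    ultimately show "T \<in> {T \<in> cycle_space (X \<times> Y). card T = 6}"
      using hexagon_props[OF RC(3-5)] by (auto simp: cycle_space_def)
  qed
  moreover have "inj_on ?h ?D"
  proof (rule inj_onI)
    fix x y assume x: "x \<in> ?D" and y: "y \<in> ?D" and eq: "?h x = ?h y"
    obtain R C f where xs: "x = ((R, C), f)" by (metis surj_pair)
    obtain R' C' f' where ys: "y = ((R', C'), f')" by (metis surj_pair)
    have RC: "card R = 3" "card C = 3" "f \<in> hexagon_data R C" using x xs by auto
    have RC': "card R' = 3" "card C' = 3" "f' \<in> hexagon_data R' C'" using y ys by auto
    have h: "hexagon R C f = hexagon R' C' f'" using eq xs ys by simp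
    then have same: "R = R'" "C = C'"
      using hexagon_props(2,3)[OF RC] hexagon_props(2,3)[OF RC'] by simp_all
    \<comment> \<open>The cell \<open>(i, f i)\<close> is missing from the first hexagon by
      construction, but would belong to the second.\<close>
    have "f i = f' i" if "i \<in> R" for i
    proof (rule ccontr)
      assume "f i \<noteq> f' i"
      moreover have "f i \<in> C" using RC(3) that by (auto simp: hexagon_data_def)
      ultimately have "(i, f i) \<in> hexagon R' C' f'"
        using same that by (auto simp: hexagon_def)
      then show False
        unfolding h[symmetric] by (simp add: hexagon_def)
    qed
    then have "f = f'"
      using RC(3) RC'(3) same by (intro PiE_ext[of f R "\<lambda>_. C"]) (auto simp: hexagon_data_def)
    then show "x = y" using same xs ys by simp
  qed
  ultimately have "card {T \<in> cycle_space (X \<times> Y). card T = 6} = card ?D"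
    by (simp add: card_image)
  also have "\<dots> = (\<Sum>x\<in>?P. card (hexagon_data (fst x) (snd x)))"
  proof (rule card_SigmaI)
    show "finite ?P" using assms by simp
    show "\<forall>x\<in>?P. finite (hexagon_data (fst x) (snd x))"
      by (auto intro!: card_ge_0_finite simp: card_hexagon_data)
  qed
  also have "\<dots> = (\<Sum>x\<in>?P. 6)"
    by (intro sum.cong refl card_hexagon_data) auto
  finally show ?thesis
    using assms by (simp add: card_cartesian_product n_subsets)
qed

text \<open>
  The only supports with at most six cells and more than one cycle are the complete bipartite
  graphs with two and three vertices.
\<close>

definition is_K23 :: "('a \<times> 'b) set \<Rightarrow> bool" where
  "is_K23 S \<longleftrightarrow> (\<exists>R C. S = R \<times> C \<and> (card R = 2 \<and> card C = 3 \<or> card R = 3 \<and> card C = 2))"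

text \<open>Transposition exchanges rows and columns, so the 3 x 2 boxes reduce to the 2 x 3
  boxes.\<close>

lemma card_cycle_space_converse: "card (cycle_space (S\<inverse>)) = card (cycle_space S)"
proof -
  have "T\<inverse> \<in> cycle_space (S\<inverse>)" if "T \<in> cycle_space S" for T :: "('c \<times> 'd) set" and S
  proof -
    have "{p \<in> T\<inverse>. fst p = i} = {p \<in> T. snd p = i}\<inverse>" "{p \<in> T\<inverse>. snd p = j} = {p \<in> T. fst p = j}\<inverse>" for i j
      by auto
    with that show ?thesis
      by (auto simp: cycle_space_def card_inverse)
  qed
  then have "converse ` cycle_space S = cycle_space (S\<inverse>)"
    by (metis (no_types, lifting) converse_converse image_eqI image_subsetI subset_antisym subsetI)
  then show ?thesis
    using card_image[of converse "cycle_space S"] by (simp add: inj_on_def)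
qed

text \<open>Two rows leave no space for a cycle of length six, so besides the empty set there are
  only the 2 x 2 boxes, one for each of the three pairs of columns.\<close>

lemma card_cycle_space_2_3:
  assumes R: "card R = 2" and C: "card C = 3"
  shows "card (cycle_space (R \<times> C)) = 4"
proof -
  have fin: "finite R" "finite C" using finite_card_2[OF R] finite_card_3[OF C] .
  have "cycle_space (R \<times> C) = insert {} ((\<lambda>C'. R \<times> C') ` {C'. C' \<subseteq> C \<and> card C' = 2})"
  proof (intro equalityI subsetI)
    fix T assume T: "T \<in> cycle_space (R \<times> C)"
    have sub: "T \<subseteq> R \<times> C" by (rule cycle_space_subset[OF T])
    have finT: "finite T" using sub fin by (auto intro: finite_subset)
    have "card (R \<times> C) = 6" using R C by (simp add: card_cartesian_product)
    then have le: "card T \<le> 6" using card_mono[OF finite_cartesian_product[OF fin] sub] by simp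
    have fsub: "fst ` T \<subseteq> R" "snd ` T \<subseteq> C" using sub by auto
    show "T \<in> insert {} ((\<lambda>C'. R \<times> C') ` {C'. C' \<subseteq> C \<and> card C' = 2})"
    proof (cases "T = {}")
      case False
      have "card T \<noteq> 6"
      proof
        assume "card T = 6"
        then show False
          using cycle_space_6(1)[OF T] card_mono[OF fin(1) fsub(1)] R by simp
      qed
      then have 4: "card T = 4"
        using cycle_space_card[OF T finT False le] by blast
      then have "fst ` T = R"
        using cycle_space_4(2)[OF T] fsub(1) fin R by (intro card_subset_eq) auto
      then have "T = R \<times> snd ` T" "card (snd ` T) = 2"
        using cycle_space_4(1,3)[OF T 4] by simp_all
      then show ?thesis using fsub(2) by blast
    qed simp
  next
    fix T assume "T \<in> insert {} ((\<lambda>C'. R \<times> C') ` {C'. C' \<subseteq> C \<and> card C' = 2})"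
    then show "T \<in> cycle_space (R \<times> C)"
      using R by (auto intro!: Times_in_cycle_space empty_in_cycle_space)
  qed
  moreover have "R \<noteq> {}" using R by auto
  then have "inj_on (\<lambda>C'. R \<times> C') {C'. C' \<subseteq> C \<and> card C' = 2}"
    by (auto simp: inj_on_def)
  moreover have "{} \<notin> (\<lambda>C'. R \<times> C') ` {C'. C' \<subseteq> C \<and> card C' = 2}"
  proof
    assume "{} \<in> (\<lambda>C'. R \<times> C') ` {C'. C' \<subseteq> C \<and> card C' = 2}"
    then show False
    proof (rule imageE)
      fix C' assume C': "{} = R \<times> C'" "C' \<in> {C'. C' \<subseteq> C \<and> card C' = 2}"
      then have "C' \<noteq> {}" by auto
      moreover have "R = {} \<or> C' = {}" using C'(1)[symmetric] by (simp only: Times_empty)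
      ultimately show False using \<open>R \<noteq> {}\<close> by simp
    qed
  qed
  ultimately show ?thesis
    using fin C by (simp add: card_image n_subsets choose_two)
qed

lemma is_K23_card:
  assumes "is_K23 S"
  shows "card (cycle_space S) = 4" "card S = 6"
proof -
  obtain R C where S: "S = R \<times> C" and "card R = 2 \<and> card C = 3 \<or> card R = 3 \<and> card C = 2"
    using assms by (auto simp: is_K23_def)
  then show "card (cycle_space S) = 4"
    using card_cycle_space_2_3[of R C] card_cycle_space_2_3[of C R]
      card_cycle_space_converse[of "R \<times> C"] by (auto simp: converse_Times)
  show "card S = 6"
    using S \<open>_ \<or> _\<close> by (auto simp: card_cartesian_product)
qed

text \<open>The symmetric difference of two distinct nonempty cycles is again a nonempty cycle, so
  three sizes are restricted to 4 or 6 while the union has at most six cells. This leaves two 2 x 2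
  boxes with a large overlap, whose union fills a 2 x 3 or 3 x 2 box.\<close>

lemma unique_cycle:
  assumes S: "finite S" "card S \<le> 6" "\<not> is_K23 S"
    and T: "T \<in> cycle_space S" "T \<noteq> {}" and U: "U \<in> cycle_space S" "U \<noteq> {}"
  shows "T = U"
proof (rule ccontr)
  assume "T \<noteq> U"
  have le6: "card V \<le> 6" "finite V" if "V \<subseteq> S" for V
    using S that card_mono[OF S(1) that] finite_subset[OF that S(1)] by auto
  have 46: "card V = 4 \<or> card V = 6" if "V \<in> cycle_space S" "V \<noteq> {}" for V
    using cycle_space_card[OF that(1) le6(2)[OF cycle_space_subset[OF that(1)]] that(2)
      le6(1)[OF cycle_space_subset[OF that(1)]]] .
  have sub: "T \<subseteq> S" "U \<subseteq> S" using T U by (auto dest: cycle_space_subset)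
  have "sym_diff T U \<noteq> {}" using \<open>T \<noteq> U\<close> by blast
  then have D: "card (sym_diff T U) = 4 \<or> card (sym_diff T U) = 6"
    using sym_diff_in_cycle_space[OF S(1) T(1) U(1)] 46 by blast
  have cards: "card T = card (T \<inter> U) + card (T - U)" "card U = card (T \<inter> U) + card (U - T)"
    using card_Int_Diff[of T U] card_Int_Diff[of U T] le6 sub by (simp_all add: Int_commute)
  have cD: "card (sym_diff T U) = card (T - U) + card (U - T)"
    using le6 sub by (intro card_Un_disjoint) auto
  have "T \<union> U = T \<union> (U - T)" by blast
  then have "card (T \<union> U) = card T + card (U - T)"
    using le6(2) sub by (metis card_Un_disjoint Diff_disjoint finite_Diff)
  moreover have "card (T \<union> U) \<le> 6" using le6 sub by simp
  \<comment> \<open>A cycle with six cells would contain the other one, and the symmetric difference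
    would have at most two cells. With both of size four, a union of at most six cells forces two
    common cells.\<close>
  ultimately have c4: "card T = 4" "card U = 4" and int: "card (T \<inter> U) \<ge> 2"
    using 46[OF T] 46[OF U] D cards cD by linarith+
  define R C R' C' where defs: "R = fst ` T" "C = snd ` T" "R' = fst ` U" "C' = snd ` U"
  note T4 = cycle_space_4[OF T(1) c4(1), folded defs] and U4 = cycle_space_4[OF U(1) c4(2), folded defs]
  have fin: "finite R" "finite C" "finite R'" "finite C'"
    using T4 U4 by (simp_all add: finite_card_2)
  have "T \<inter> U = (R \<inter> R') \<times> (C \<inter> C')"
    using T4(1) U4(1) by blast
  then have prod: "card (R \<inter> R') * card (C \<inter> C') \<ge> 2"
    using int by (simp add: card_cartesian_product)
  have eqI: "A = B" if "card A = 2" "card B = 2" "card (A \<inter> B) \<ge> 2" for A B :: "'x set"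
  proof -
    have fin: "finite A" "finite B" using that by (simp_all add: finite_card_2)
    then have "card (A \<inter> B) = 2"
      using that card_mono[of A "A \<inter> B"] by auto
    then have "A \<inter> B = A" "A \<inter> B = B"
      using card_subset_eq[OF fin(1), of "A \<inter> B"] card_subset_eq[OF fin(2), of "A \<inter> B"] that(1,2)
      by (metis Int_lower1, metis Int_lower2)
    then show ?thesis by simp
  qed
  have un3: "card (A \<union> B) = 3" if "card A = 2" "card B = 2" "card (A \<inter> B) = 1" for A B :: "'x set"
    using that card_Un_Int[of A B] by (simp add: finite_card_2)
  have "card (R \<inter> R') \<noteq> 0" "card (C \<inter> C') \<noteq> 0" using prod by (auto intro: ccontr)
  then have "card (R \<inter> R') = 1 \<or> card (R \<inter> R') \<ge> 2" "card (C \<inter> C') = 1 \<or> card (C \<inter> C') \<ge> 2"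
    by linarith+
  \<comment> \<open>The overlap is itself a box with at least two cells, so both rows or both
    columns are shared; the union in the last two cases has six cells and exhausts
    \<open>S\<close>.\<close>
  then consider "R = R'" "C = C'" | "R = R'" "card (C \<inter> C') = 1" | "card (R \<inter> R') = 1" "C = C'"
    using prod eqI[of R R'] eqI[of C C'] T4 U4 by fastforce
  then show False
  proof cases
    case 1
    then show False using T4(1) U4(1) \<open>T \<noteq> U\<close> by simp
  next
    case 2
    then have "card (C \<union> C') = 3" using T4 U4 by (simp add: un3)
    moreover have "R \<times> (C \<union> C') \<subseteq> S"
      using T4(1) U4(1) sub 2 by blast
    ultimately have "R \<times> (C \<union> C') = S"
      using S(1,2) T4(2) card_mono[OF S(1), of "R \<times> (C \<union> C')"]
      by (intro card_subset_eq) (auto simp: card_cartesian_product)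
    with S(3) \<open>card (C \<union> C') = 3\<close> T4(2) show False
      unfolding is_K23_def by blast
  next
    case 3
    then have "card (R \<union> R') = 3" using T4 U4 by (simp add: un3)
    moreover have "(R \<union> R') \<times> C \<subseteq> S"
      using T4(1) U4(1) sub 3 by blast
    ultimately have "(R \<union> R') \<times> C = S"
      using S(1,2) T4(3) card_mono[OF S(1), of "(R \<union> R') \<times> C"]
      by (intro card_subset_eq) (auto simp: card_cartesian_product)
    with S(3) \<open>card (R \<union> R') = 3\<close> T4(3) show False
      unfolding is_K23_def by blast
  qed
qed

lemma card_cycle_space_cases:
  assumes "finite S" "card S \<le> 6"
  shows "card (cycle_space S) = (if is_K23 S then 4 else if cycle_space S = {{}} then 1 else 2)"
proof -
  have "card (cycle_space S) = 2" if K: "\<not> is_K23 S" and ne: "cycle_space S \<noteq> {{}}"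
  proof -
    obtain T where T: "T \<in> cycle_space S" "T \<noteq> {}"
      using ne empty_in_cycle_space[of S] by blast
    then have "cycle_space S = {{}, T}"
      using unique_cycle[OF assms K _ _ T] empty_in_cycle_space[of S] by blast
    with T(2) show ?thesis by simp
  qed
  then show ?thesis
    using is_K23_card(1)[of S] by auto
qed

lemma card_K23_subsets:
  assumes "finite X" "finite Y"
  shows "card {K. K \<subseteq> X \<times> Y \<and> is_K23 K} =
    (card X choose 2) * (card Y choose 3) + (card X choose 3) * (card Y choose 2)"
proof -
  have "{K. K \<subseteq> X \<times> Y \<and> is_K23 K} = boxes X Y 2 3 \<union> boxes X Y 3 2"
  proof (intro equalityI subsetI)
    fix K assume "K \<in> {K. K \<subseteq> X \<times> Y \<and> is_K23 K}"
    then obtain R C where K: "K = R \<times> C" "R \<times> C \<subseteq> X \<times> Y"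
      "card R = 2 \<and> card C = 3 \<or> card R = 3 \<and> card C = 2" by (auto simp: is_K23_def)
    then have "R \<noteq> {}" "C \<noteq> {}" by auto
    then have "R \<subseteq> X" "C \<subseteq> Y" using K(2) by (simp_all add: times_subset_iff)
    with K show "K \<in> boxes X Y 2 3 \<union> boxes X Y 3 2"
      unfolding Un_iff mem_boxes_iff by blast
  next
    fix K assume "K \<in> boxes X Y 2 3 \<union> boxes X Y 3 2"
    then obtain R C where K: "K = R \<times> C" "R \<subseteq> X" "C \<subseteq> Y"
      "card R = 2 \<and> card C = 3 \<or> card R = 3 \<and> card C = 2"
      unfolding Un_iff mem_boxes_iff by blast
    then have "R \<times> C \<subseteq> X \<times> Y" by blast
    with K show "K \<in> {K. K \<subseteq> X \<times> Y \<and> is_K23 K}"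
      unfolding is_K23_def by blast
  qed
  moreover have "boxes X Y 2 3 \<inter> boxes X Y 3 2 = {}"
  proof (rule equals0I)
    fix T assume "T \<in> boxes X Y 2 3 \<inter> boxes X Y 3 2"
    then have "T \<in> boxes X Y 2 3" "T \<in> boxes X Y 3 2" by simp_all
    then obtain R C R' C' where "T = R \<times> C" "T = R' \<times> C'" and
      T: "card R = 2" "card C = 3" "card R' = 3" "card C' = 2"
      unfolding mem_boxes_iff by (elim exE conjE) (rule that)
    then have eq: "R \<times> C = R' \<times> C'" by simp
    have "R \<noteq> {}" "C \<noteq> {}" using T by auto
    then have "R = R'" using eq by (simp add: times_eq_iff)
    with T(1,3) show False by simp
  qed
  moreover have "finite (boxes X Y a b)" for a b
    using assms by (simp add: boxes_def)
  ultimately show ?thesis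
    using assms by (simp add: card_Un_disjoint card_boxes)
qed

section \<open>Counting entry specifications\<close>

text \<open>\<open>m\<close> is the side of the inner square, later instantiated with
  \<open>n - 1\<close>.\<close>

definition specs :: "nat \<Rightarrow> nat \<Rightarrow> array set" where
  "specs m k = (\<Union>I\<in>{I. I \<subseteq> square m \<and> card I = k}. arrays I)"

lemma mem_specs_iff: "B \<in> specs m k \<longleftrightarrow> B \<in> arrays (dom B) \<and> dom B \<subseteq> square m \<and> card (dom B) = k"
  using arrays_dom by (auto simp: specs_def)

lemma finite_arrays: "finite I \<Longrightarrow> finite (arrays I)"
  unfolding arrays_eq_PiE_dflt by (rule finite_PiE_dflt) auto

lemma finite_specs: "finite (specs m k)"
  unfolding specs_def by (intro finite_UN_I finite_arrays) (auto intro: finite_subset[OF _ finite_square])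

lemma supp_subset_dom: "supp B \<subseteq> dom B"
  by (auto simp: supp_def)

lemma finite_supp_specs:
  assumes "B \<in> specs m k"
  shows "finite (supp B)" "card (supp B) \<le> k" "supp B \<subseteq> square m"
proof -
  have "finite (dom B)" "card (dom B) = k" "dom B \<subseteq> square m"
    using assms by (auto simp: mem_specs_iff intro: finite_subset[OF _ finite_square])
  then show "finite (supp B)" "card (supp B) \<le> k" "supp B \<subseteq> square m"
    using supp_subset_dom[of B] card_mono[of "dom B" "supp B"] by (auto intro: finite_subset)
qed

lemma specs_signs:
  assumes "B \<in> specs m k" "p \<in> supp B"
  shows "- the (B p) \<in> {-1, 1}"
proof -
  have "p \<in> dom B" "B p \<noteq> Some 0" using assms(2) by (auto simp: supp_def)
  moreover have "B \<in> arrays (dom B)" using assms(1) by (simp add: mem_specs_iff)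
  ultimately show ?thesis using arrays_entry[of B "dom B" p] by auto
qed

lemma card_arrays_supp:
  assumes "finite I" "T \<subseteq> I"
  shows "card {B \<in> arrays I. T \<subseteq> supp B} = 2 ^ card T * 3 ^ (card I - card T)"
proof -
  have "{B \<in> arrays I. T \<subseteq> supp B} =
      PiE_dflt I None (\<lambda>p. Some ` (if p \<in> T then {-1, 1} else {-1, 0, 1}))"
  proof (intro set_eqI)
    fix B
    have "(B p \<in> Some ` (if p \<in> T then {-1, 1} else {-1, 0, 1})) \<longleftrightarrow>
        B p \<in> Some ` {-1, 0, 1} \<and> (p \<in> T \<longrightarrow> p \<in> supp B)" for p
      by (cases "p \<in> T") (auto simp: supp_def)
    then show "B \<in> {B \<in> arrays I. T \<subseteq> supp B} \<longleftrightarrow>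
        B \<in> PiE_dflt I None (\<lambda>p. Some ` (if p \<in> T then {-1, 1} else {-1, 0, 1}))"
      using assms(2) unfolding arrays_eq_PiE_dflt PiE_dflt_def by blast
  qed
  also have "card \<dots> = (\<Prod>p\<in>I. card (Some ` (if p \<in> T then {-1, 1} else {-1, 0, 1 :: int})))"
    by (rule card_PiE_dflt) (use assms in auto)
  also have "\<dots> = (\<Prod>p\<in>I. if p \<in> T then 2 else 3)"
    by (intro prod.cong) (auto simp: card_image)
  also have "\<dots> = 2 ^ card (I \<inter> T) * 3 ^ card (I - T)"
    using assms(1) by (subst prod.If_cases) (simp_all add: Diff_eq)
  also have "I \<inter> T = T" using assms(2) by blast
  also have "card (I - T) = card I - card T"
    using assms by (simp add: card_Diff_subset finite_subset)
  finally show ?thesis .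
qed

lemma card_supersets:
  assumes "finite Q" "T \<subseteq> Q" "card T \<le> k"
  shows "card {I. T \<subseteq> I \<and> I \<subseteq> Q \<and> card I = k} = (card Q - card T) choose (k - card T)"
proof -
  have finT: "finite T" using assms finite_subset by blast
  have "bij_betw (\<lambda>I. I - T) {I. T \<subseteq> I \<and> I \<subseteq> Q \<and> card I = k} {J. J \<subseteq> Q - T \<and> card J = k - card T}"
  proof (rule bij_betw_byWitness[where f' = "\<lambda>J. J \<union> T"])
    show "(\<lambda>I. I - T) ` {I. T \<subseteq> I \<and> I \<subseteq> Q \<and> card I = k} \<subseteq> {J. J \<subseteq> Q - T \<and> card J = k - card T}"
      using finT by (auto simp: card_Diff_subset)
    show "(\<lambda>J. J \<union> T) ` {J. J \<subseteq> Q - T \<and> card J = k - card T} \<subseteq> {I. T \<subseteq> I \<and> I \<subseteq> Q \<and> card I = k}"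
    proof (rule image_subsetI)
      fix J assume J: "J \<in> {J. J \<subseteq> Q - T \<and> card J = k - card T}"
      then have "finite J" using assms(1) by (auto intro: finite_subset)
      moreover have "J \<inter> T = {}" using J by auto
      ultimately have "card (J \<union> T) = k"
        using J finT assms(3) by (simp add: card_Un_disjoint)
      then show "J \<union> T \<in> {I. T \<subseteq> I \<and> I \<subseteq> Q \<and> card I = k}" using J assms(2) by auto
    qed
  qed auto
  then have "card {I. T \<subseteq> I \<and> I \<subseteq> Q \<and> card I = k} = card {J. J \<subseteq> Q - T \<and> card J = k - card T}"
    by (rule bij_betw_same_card)
  also have "\<dots> = card (Q - T) choose (k - card T)"
    using assms(1) by (simp add: n_subsets)
  finally show ?thesis
    using finT assms(2) by (simp add: card_Diff_subset)
qed

text \<open>Containment rather than equality of the support is prescribed: a cell of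
  \<open>T\<close> has two possible values, every other specified cell has three, and the rest of
  the domain is an arbitrary set of cells outside \<open>T\<close>.\<close>

lemma card_specs_supp:
  assumes T: "T \<subseteq> square m" "card T \<le> k"
  shows "card {B \<in> specs m k. T \<subseteq> supp B} =
    2 ^ card T * 3 ^ (k - card T) * ((m\<^sup>2 - card T) choose (k - card T))"
proof -
  let ?\<I> = "{I. T \<subseteq> I \<and> I \<subseteq> square m \<and> card I = k}"
  have fin: "finite I" if "I \<in> ?\<I>" for I
    using that by (auto intro: finite_subset[OF _ finite_square])
  have "{B \<in> specs m k. T \<subseteq> supp B} = (\<Union>I\<in>?\<I>. {B \<in> arrays I. T \<subseteq> supp B})"
  proof (intro equalityI subsetI)
    fix B assume B: "B \<in> {B \<in> specs m k. T \<subseteq> supp B}"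
    then have "dom B \<in> ?\<I>"
      using supp_subset_dom[of B] by (auto simp: mem_specs_iff)
    then show "B \<in> (\<Union>I\<in>?\<I>. {B \<in> arrays I. T \<subseteq> supp B})"
      using B unfolding mem_Collect_eq mem_specs_iff[of B] by blast
  next
    fix B assume "B \<in> (\<Union>I\<in>?\<I>. {B \<in> arrays I. T \<subseteq> supp B})"
    then show "B \<in> {B \<in> specs m k. T \<subseteq> supp B}"
      unfolding specs_def by blast
  qed
  also have "card \<dots> = (\<Sum>I\<in>?\<I>. card {B \<in> arrays I. T \<subseteq> supp B})"
  proof (rule card_UN_disjoint)
    show "finite ?\<I>"
      by (rule finite_subset[of _ "Pow (square m)"]) auto
    show "\<forall>I\<in>?\<I>. finite {B \<in> arrays I. T \<subseteq> supp B}"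
      using fin finite_arrays by auto
    show "\<forall>I\<in>?\<I>. \<forall>J\<in>?\<I>. I \<noteq> J \<longrightarrow> {B \<in> arrays I. T \<subseteq> supp B} \<inter> {B \<in> arrays J. T \<subseteq> supp B} = {}"
      using arrays_dom by blast
  qed
  also have "\<dots> = (\<Sum>I\<in>?\<I>. 2 ^ card T * 3 ^ (k - card T))"
    using fin by (intro sum.cong refl) (auto simp: card_arrays_supp)
  also have "\<dots> = card ?\<I> * (2 ^ card T * 3 ^ (k - card T))"
    by simp
  finally show ?thesis
    using card_supersets[OF finite_square T] by (simp add: mult_ac)
qed

lemma card_specs: "card (specs m k) = 3 ^ k * (m\<^sup>2 choose k)"
  using card_specs_supp[of "{}" m k] by simp

section \<open>The mean of the ratio over all signs\<close>

definition flip :: "nat \<times> nat \<Rightarrow> array \<Rightarrow> array" where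
  "flip p B = B(p := map_option uminus (B p))"

lemma flip_props:
  shows "flip p (flip p B) = B" "dom (flip p B) = dom B" "supp (flip p B) = supp B"
    "B \<in> specs m k \<Longrightarrow> flip p B \<in> specs m k"
proof -
  show "flip p (flip p B) = B"
    by (cases "B p") (auto simp: flip_def)
  show d: "dom (flip p B) = dom B"
    by (auto simp: flip_def split: if_splits)
  show "supp (flip p B) = supp B"
    unfolding supp_def d by (auto simp: flip_def split: if_splits)
  assume B: "B \<in> specs m k"
  have "flip p B q \<in> Some ` {-1, 0, 1}" if "B q \<in> Some ` {-1, 0, 1}" for q
    using that by (auto simp: flip_def)
  moreover have "flip p B q = None" if "B q = None" for q
    using that by (auto simp: flip_def)
  ultimately have "flip p B \<in> arrays (dom B)"
    using B unfolding mem_specs_iff arrays_eq_PiE_dflt PiE_dflt_def by blast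
  then show "flip p B \<in> specs m k"
    using B d by (simp add: mem_specs_iff)
qed

lemma prod_flip_array:
  assumes "finite T" "p \<in> T" "T \<subseteq> supp B"
  shows "(\<Prod>q\<in>T. - the (flip p B q)) = - (\<Prod>q\<in>T. - the (B q))"
proof -
  have "p \<in> dom B" using assms supp_subset_dom by blast
  then have "the (flip p B p) = - the (B p)"
    by (auto simp: flip_def)
  moreover have "(\<Prod>q\<in>T - {p}. - the (flip p B q)) = (\<Prod>q\<in>T - {p}. - the (B q))"
    by (intro prod.cong) (auto simp: flip_def)
  ultimately show ?thesis
    using prod.remove[OF assms(1,2), of "\<lambda>q. - the (flip p B q)"]
      prod.remove[OF assms(1,2), of "\<lambda>q. - the (B q)"] by simp
qed

text \<open>
  Reversing one sign of a cycle pairs off the contributions of the nonempty cycles, so on average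
  only the empty cycle contributes to \<open>chio_ratio\<close>.
\<close>

lemma sum_chio_ratio:
  "(\<Sum>B\<in>{B \<in> specs m k. P (supp B)}. chio_ratio B) = int (card {B \<in> specs m k. P (supp B)})"
proof -
  let ?X = "{B \<in> specs m k. P (supp B)}"
  let ?Y = "SIGMA B:?X. cycle_space (supp B)"
  let ?Z = "{x \<in> ?Y. snd x \<noteq> {}}"
  let ?f = "\<lambda>x. \<Prod>p\<in>snd x. - the (fst x p)"
  have finX: "finite ?X" using finite_specs by simp
  have finY: "finite ?Y"
    using finX finite_supp_specs(1) by (intro finite_SigmaI finite_cycle_space) auto
  \<comment> \<open>The reversed cell is chosen from the cycle alone, which \<open>g\<close> leaves
    unchanged; a second application therefore picks the same cell and undoes the first.\<close>
  define g where "g x = (flip (SOME p. p \<in> snd x) (fst x), snd x)" for x :: "array \<times> (nat \<times> nat) set"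
  have zero: "sum ?f ?Z = 0"
  proof (rule sum_sign_reversing_involution[where g = g])
    fix x assume x: "x \<in> ?Z"
    obtain B T where "x = (B, T)" by (metis surj_pair)
    with x have BT: "x = (B, T)" "B \<in> specs m k" "P (supp B)" "T \<in> cycle_space (supp B)" "T \<noteq> {}"
      by simp_all
    have T: "T \<subseteq> supp B" "finite T"
      using cycle_space_subset[OF BT(4)] finite_supp_specs(1)[OF BT(2)] by (auto intro: finite_subset)
    show "g x \<in> ?Z" "g (g x) = x"
      using BT by (simp_all add: g_def flip_props)
    have "(SOME p. p \<in> T) \<in> T" using BT(5) by (simp add: some_in_eq)
    then show "?f (g x) = - ?f x"
      using prod_flip_array[OF T(2) _ T(1)] by (simp add: g_def BT(1))
  qed
  have "?Y - ?Z = ?X \<times> {{}}"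
    using empty_in_cycle_space by auto
  then have "sum ?f (?Y - ?Z) = sum ?f (?X \<times> {{}})"
    by (simp only:)
  also have "\<dots> = (\<Sum>x\<in>?X \<times> {{} :: (nat \<times> nat) set}. 1)"
    by (rule sum.cong) auto
  finally have "sum ?f (?Y - ?Z) = int (card ?X)"
    by (simp add: card_cartesian_product)
  moreover have "sum ?f ?Y = sum ?f (?Y - ?Z) + sum ?f ?Z"
    by (rule sum.subset_diff[OF _ finY]) blast
  ultimately have "sum ?f ?Y = int (card ?X)"
    using zero by simp
  moreover have "sum ?f ?Y = (\<Sum>B\<in>?X. \<Sum>T\<in>cycle_space (supp B). \<Prod>p\<in>T. - the (B p))"
    using finX finite_supp_specs(1) by (subst sum.Sigma) (auto simp: case_prod_unfold finite_cycle_space)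
  ultimately show ?thesis by (simp add: chio_ratio_def)
qed

lemma chio_ratio_cases:
  assumes "B \<in> specs m k"
  shows "chio_ratio B \<in> {0, int (card (cycle_space (supp B)))}"
  unfolding chio_ratio_def
  by (rule sum_cycle_space) (use finite_supp_specs(1) specs_signs assms in blast)+

section \<open>Arrays classified by the order of the cycle space\<close>

definition cyclic_specs :: "nat \<Rightarrow> nat \<Rightarrow> nat \<Rightarrow> array set" where
  "cyclic_specs m k e = {B \<in> specs m k. card (cycle_space (supp B)) = e}"

lemma finite_cyclic_specs: "finite (cyclic_specs m k e)"
  using finite_specs by (simp add: cyclic_specs_def)

text \<open>The class is defined through the support, so the ratio has mean 1 on it; as only the
  values 0 and \<open>e\<close> occur, the value \<open>e\<close> is taken by the proportion 1 /
  \<open>e\<close>.\<close>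

lemma card_balanced:
  "e * card {B \<in> cyclic_specs m k e. chio_ratio B = int e} = card (cyclic_specs m k e)"
proof -
  have "int (card (cyclic_specs m k e)) = (\<Sum>B\<in>cyclic_specs m k e. chio_ratio B)"
    unfolding cyclic_specs_def using sum_chio_ratio[of m k "\<lambda>S. card (cycle_space S) = e"] by simp
  also have "\<dots> = (\<Sum>B\<in>cyclic_specs m k e. if chio_ratio B = int e then int e else 0)"
    using chio_ratio_cases by (intro sum.cong refl) (force simp: cyclic_specs_def)
  also have "\<dots> = int (e * card {B \<in> cyclic_specs m k e. chio_ratio B = int e})"
    using finite_cyclic_specs by (simp add: sum.inter_filter[symmetric])
  finally show ?thesis by linarith
qed

lemma card_cycle_space_specs:
  assumes "k \<le> 6" "B \<in> specs m k"
  shows "card (cycle_space (supp B)) \<in> {1, 2, 4}"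
  using card_cycle_space_cases[of "supp B"] finite_supp_specs[OF assms(2)] assms(1) by (auto split: if_splits)

text \<open>Ratio 0 is taken by half of the class of order 2 and by three quarters of the class of
  order 4, that is, as often as ratio 2 plus three times as often as ratio 4. In the class of order
  1 the ratio is always 1.\<close>

lemma card_ratio:
  assumes "k \<le> 6"
  shows "2 * card {B \<in> specs m k. chio_ratio B = 2} = card (cyclic_specs m k 2)"
    "4 * card {B \<in> specs m k. chio_ratio B = 4} = card (cyclic_specs m k 4)"
    "card {B \<in> specs m k. chio_ratio B = 0} =
       card {B \<in> specs m k. chio_ratio B = 2} + 3 * card {B \<in> specs m k. chio_ratio B = 4}"
    "card {B \<in> specs m k. chio_ratio B \<noteq> 1} = card {B \<in> specs m k. chio_ratio B = 0} +
       card {B \<in> specs m k. chio_ratio B = 2} + card {B \<in> specs m k. chio_ratio B = 4}"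
proof -
  let ?S = "\<lambda>r. {B \<in> specs m k. chio_ratio B = r}"
  \<comment> \<open>A nonzero ratio equals the order of the cycle space, so it already determines
    the class.\<close>
  have S: "{B \<in> cyclic_specs m k e. chio_ratio B = int e} = ?S (int e)" if "e > 0" for e
    using that chio_ratio_cases by (force simp: cyclic_specs_def)
  have 1: "e * card (?S (int e)) = card (cyclic_specs m k e)" if "e > 0" for e
    using card_balanced[of e m k] S[OF that] by simp
  show 2: "2 * card (?S 2) = card (cyclic_specs m k 2)" and 4: "4 * card (?S 4) = card (cyclic_specs m k 4)"
    using 1[of 2] 1[of 4] by simp_all
  have fin: "finite (?S r)" for r using finite_specs by simp
  have ratio: "chio_ratio B \<in> {0, 1, 2, 4}" if "B \<in> specs m k" for B
    using chio_ratio_cases[OF that] card_cycle_space_specs[OF assms that] by auto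
  then have union: "specs m k = ?S 0 \<union> (?S 1 \<union> (?S 2 \<union> ?S 4))"
    by blast
  have "card (?S 0 \<union> (?S 1 \<union> (?S 2 \<union> ?S 4))) = card (?S 0) + (card (?S 1) + (card (?S 2) + card (?S 4)))"
    using fin by (simp add: card_Un_disjoint disjoint_iff)
  then have "card (specs m k) = card (?S 0) + (card (?S 1) + (card (?S 2) + card (?S 4)))"
    by (simp only: union[symmetric])
  moreover have "card (specs m k) = card (cyclic_specs m k 1) + (card (cyclic_specs m k 2) + card (cyclic_specs m k 4))"
  proof -
    have "specs m k = cyclic_specs m k 1 \<union> (cyclic_specs m k 2 \<union> cyclic_specs m k 4)"
      using card_cycle_space_specs[OF assms, of _ m] unfolding cyclic_specs_def by blast
    also have "card \<dots> = card (cyclic_specs m k 1) + (card (cyclic_specs m k 2) + card (cyclic_specs m k 4))"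
    proof -
      have "cyclic_specs m k i \<inter> cyclic_specs m k j = {}" if "i \<noteq> j" for i j
        using that by (auto simp: cyclic_specs_def)
      then show ?thesis
        by (simp add: card_Un_disjoint finite_cyclic_specs Int_Un_distrib)
    qed
    finally show ?thesis .
  qed
  ultimately show "card (?S 0) = card (?S 2) + 3 * card (?S 4)"
    using 1[of 1] 2 4 by simp
  have "{B \<in> specs m k. chio_ratio B \<noteq> 1} = ?S 0 \<union> (?S 2 \<union> ?S 4)"
    using ratio by fastforce
  then show "card {B \<in> specs m k. chio_ratio B \<noteq> 1} = card (?S 0) + card (?S 2) + card (?S 4)"
    using fin by (simp add: card_Un_disjoint disjoint_iff)
qed

text \<open>Double counting of arrays paired with a nonempty cycle in their support: orders 1, 2 and
  4 yield 0, 1 and 3 such cycles.\<close>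

lemma sum_cyclic_specs:
  assumes "k \<le> 6"
  shows "card (cyclic_specs m k 2) + 3 * card (cyclic_specs m k 4) =
    (\<Sum>T\<in>cycle_space (square m) - {{}}. card {B \<in> specs m k. T \<subseteq> supp B})"
proof -
  let ?c = "\<lambda>B. card (cycle_space (supp B))"
  have "(\<Sum>T\<in>cycle_space (square m) - {{}}. card {B \<in> specs m k. T \<subseteq> supp B}) =
      (\<Sum>T\<in>cycle_space (square m) - {{}}. \<Sum>B\<in>{B \<in> specs m k. T \<subseteq> supp B}. 1)"
    by simp
  also have "\<dots> = (\<Sum>B\<in>specs m k. \<Sum>T\<in>{T \<in> cycle_space (square m) - {{}}. T \<subseteq> supp B}. 1)"
    by (rule sum.swap_restrict) (simp_all add: finite_specs finite_cycle_space)
  also have "\<dots> = (\<Sum>B\<in>specs m k. (if ?c B = 2 then 1 else 0) + (if ?c B = 4 then 3 else 0))"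
  proof (rule sum.cong[OF refl])
    fix B assume B: "B \<in> specs m k"
    have "?c B \<in> {1, 2, 4}"
      using assms B by (rule card_cycle_space_specs)
    moreover have "{T \<in> cycle_space (square m) - {{}}. T \<subseteq> supp B} = cycle_space (supp B) - {{}}"
      using finite_supp_specs(3)[OF B] unfolding cycle_space_def by blast
    then have "(\<Sum>T\<in>{T \<in> cycle_space (square m) - {{}}. T \<subseteq> supp B}. 1 :: nat) = card (cycle_space (supp B) - {{}})"
      by (simp only: card_eq_sum)
    then have "(\<Sum>T\<in>{T \<in> cycle_space (square m) - {{}}. T \<subseteq> supp B}. 1 :: nat) = ?c B - 1"
      by (simp only: card_Diff_singleton[OF empty_in_cycle_space])
    ultimately show "(\<Sum>T\<in>{T \<in> cycle_space (square m) - {{}}. T \<subseteq> supp B}. 1) =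
        (if ?c B = 2 then 1 else 0) + (if ?c B = 4 then 3 else 0 :: nat)"
      by (elim insertE emptyE; simp only:; simp)
  qed
  also have "\<dots> = card (cyclic_specs m k 2) + 3 * card (cyclic_specs m k 4)"
    using finite_specs by (simp add: sum.distrib sum.inter_filter[symmetric] cyclic_specs_def)
  finally show ?thesis by simp
qed

lemma card_4_cycles_square: "card {T \<in> cycle_space (square m). card T = 4} = (m choose 2)\<^sup>2"
  and card_6_cycles_square: "card {T \<in> cycle_space (square m). card T = 6} = 6 * (m choose 3)\<^sup>2"
  and card_K23_square: "card {K. K \<subseteq> square m \<and> is_K23 K} = 2 * (m choose 2) * (m choose 3)"
  using card_4_cycles[of "{1..m}" "{1..m}"] card_6_cycles[of "{1..m}" "{1..m}"] card_K23_subsets[of "{1..m}" "{1..m}"]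
  by (simp_all add: square_def power2_eq_square)

text \<open>Only lengths 4 and 6 contribute. The constants 16 and 64 are the numbers of sign
  patterns on such a cycle; one of length six leaves no further cell to specify.\<close>

lemma sum_cycles:
  assumes "k \<le> 6"
  shows "(\<Sum>T\<in>cycle_space (square m) - {{}}. card {B \<in> specs m k. T \<subseteq> supp B}) =
    (if k \<ge> 4 then (m choose 2)\<^sup>2 * (16 * 3 ^ (k - 4) * ((m\<^sup>2 - 4) choose (k - 4))) else 0) +
    (if k = 6 then 6 * (m choose 3)\<^sup>2 * 64 else 0)"
proof -
  let ?C = "\<lambda>i. {T \<in> cycle_space (square m). card T = i}"
  let ?F = "\<lambda>T. card {B \<in> specs m k. T \<subseteq> supp B}"
  have fin: "finite (cycle_space (square m))" by (simp add: finite_cycle_space)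
  \<comment> \<open>A cycle larger than the domain fits into no support, which disposes of all the
    longer cycles of the full square.\<close>
  have zero: "?F T = 0" if "card T > k" for T
  proof -
    have "card T \<le> k" if "B \<in> specs m k" "T \<subseteq> supp B" for B
      using finite_supp_specs(1,2)[OF that(1)] card_mono[OF _ that(2)] by fastforce
    then have "{B \<in> specs m k. T \<subseteq> supp B} = {}" using that by fastforce
    then show ?thesis by (simp only: card.empty)
  qed
  have sub: "T \<subseteq> square m" "finite T" if "T \<in> cycle_space (square m)" for T
    using cycle_space_subset[OF that] by (auto intro: finite_subset[OF _ finite_square])
  have "sum ?F (cycle_space (square m) - {{}}) = sum ?F (?C 4 \<union> ?C 6)"
  proof (rule sum.mono_neutral_right)
    show "\<forall>T\<in>cycle_space (square m) - {{}} - (?C 4 \<union> ?C 6). ?F T = 0"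
    proof
      fix T assume T: "T \<in> cycle_space (square m) - {{}} - (?C 4 \<union> ?C 6)"
      then have "card T > 6"
        using cycle_space_card[of T "square m"] sub[of T] by force
      then show "?F T = 0" using zero assms by simp
    qed
  qed (use fin in auto)
  also have "\<dots> = sum ?F (?C 4) + sum ?F (?C 6)"
    using fin by (intro sum.union_disjoint) auto
  also have "sum ?F (?C 4) = (\<Sum>T\<in>?C 4. if k \<ge> 4 then 16 * 3 ^ (k - 4) * ((m\<^sup>2 - 4) choose (k - 4)) else 0)"
    using zero card_specs_supp[of _ m k] sub by (intro sum.cong refl) auto
  also have "\<dots> = (if k \<ge> 4 then (m choose 2)\<^sup>2 * (16 * 3 ^ (k - 4) * ((m\<^sup>2 - 4) choose (k - 4))) else 0)"
    by (simp add: card_4_cycles_square)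
  also have "sum ?F (?C 6) = (\<Sum>T\<in>?C 6. if k = 6 then 64 else 0)"
    using zero card_specs_supp[of _ m 6] sub assms by (intro sum.cong refl) auto
  also have "\<dots> = (if k = 6 then 6 * (m choose 3)\<^sup>2 * 64 else 0)"
    by (simp add: card_6_cycles_square)
  finally show ?thesis .
qed

text \<open>A support with cycle space of order 4 has six cells, hence is the whole domain and all
  entries are signs. Each of the 2 x 3 and 3 x 2 boxes carries 2^6 sign patterns.\<close>

lemma card_cyclic_specs_4:
  assumes "k \<le> 6"
  shows "card (cyclic_specs m k 4) = (if k = 6 then 128 * (m choose 2) * (m choose 3) else 0)"
proof -
  let ?K = "{K. K \<subseteq> square m \<and> is_K23 K}"
  have supp_K: "is_K23 (supp B) \<and> k = 6" if "B \<in> cyclic_specs m k 4" for B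
  proof -
    have B: "B \<in> specs m k" "card (cycle_space (supp B)) = 4"
      using that by (simp_all add: cyclic_specs_def)
    then have "is_K23 (supp B)"
      using card_cycle_space_cases[of "supp B"] finite_supp_specs[OF B(1)] assms by (auto split: if_splits)
    then show ?thesis
      using is_K23_card(2) finite_supp_specs(2)[OF B(1)] assms by fastforce
  qed
  show ?thesis
  proof (cases "k = 6")
    case False
    then have "cyclic_specs m k 4 = {}" using supp_K by blast
    with False show ?thesis by simp
  next
    case True
    \<comment> \<open>Six cells inside a support of at most six cells: containment is equality, so
      different boxes give disjoint families.\<close>
    have eq: "supp B = K" if "B \<in> specs m k" "K \<subseteq> supp B" "is_K23 K" for B K
      using finite_supp_specs(1,2)[OF that(1)] that(2) is_K23_card(2)[OF that(3)] True
      by (metis card_seteq)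
    have "cyclic_specs m k 4 = (\<Union>K\<in>?K. {B \<in> specs m k. K \<subseteq> supp B})"
    proof (intro equalityI subsetI)
      fix B assume "B \<in> cyclic_specs m k 4"
      then have "is_K23 (supp B)" "B \<in> specs m k"
        using supp_K by (simp_all add: cyclic_specs_def)
      then show "B \<in> (\<Union>K\<in>?K. {B \<in> specs m k. K \<subseteq> supp B})"
        using finite_supp_specs(3) by blast
    next
      fix B assume "B \<in> (\<Union>K\<in>?K. {B \<in> specs m k. K \<subseteq> supp B})"
      then obtain K where K: "is_K23 K" "B \<in> specs m k" "K \<subseteq> supp B" by blast
      then show "B \<in> cyclic_specs m k 4"
        using eq[OF K(2,3,1)] is_K23_card(1)[OF K(1)] by (simp add: cyclic_specs_def)
    qed
    also have "card \<dots> = (\<Sum>K\<in>?K. card {B \<in> specs m k. K \<subseteq> supp B})"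
    proof (rule card_UN_disjoint)
      show "finite ?K"
        by (rule finite_subset[of _ "Pow (square m)"]) auto
      show "\<forall>K\<in>?K. finite {B \<in> specs m k. K \<subseteq> supp B}"
        using finite_specs by simp
      show "\<forall>K\<in>?K. \<forall>K'\<in>?K. K \<noteq> K' \<longrightarrow> {B \<in> specs m k. K \<subseteq> supp B} \<inter> {B \<in> specs m k. K' \<subseteq> supp B} = {}"
        using eq by blast
    qed
    also have "\<dots> = (\<Sum>K\<in>?K. 64)"
    proof (rule sum.cong[OF refl])
      fix K assume "K \<in> ?K"
      then have "K \<subseteq> square m" "card K = 6" using is_K23_card(2) by auto
      then show "card {B \<in> specs m k. K \<subseteq> supp B} = 64"
        using card_specs_supp[of K m k] True by simp
    qed
    also have "\<dots> = 128 * (m choose 2) * (m choose 3)"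
      by (simp add: card_K23_square)
    finally show ?thesis using True by simp
  qed
qed

section \<open>Polynomial formulas and asymptotics\<close>

text \<open>No lower bound on \<open>N\<close> is required: for smaller \<open>N\<close> one of the
  factors vanishes.\<close>

lemma real_choose:
  "real (N choose 2) = real N * (real N - 1) / 2"
  "real (N choose 3) = real N * (real N - 1) * (real N - 2) / 6"
  "real (N choose 4) = real N * (real N - 1) * (real N - 2) * (real N - 3) / 24"
  "real (N choose 5) = real N * (real N - 1) * (real N - 2) * (real N - 3) * (real N - 4) / 120"
  "real (N choose 6) =
    real N * (real N - 1) * (real N - 2) * (real N - 3) * (real N - 4) * (real N - 5) / 720"
  by (simp_all add: binomial_gbinomial gbinomial_prod_rev numeral_eq_Suc fact_Suc prod.atLeast0_lessThan_Suc)

lemma pred_square: "n \<ge> 1 \<Longrightarrow> real ((n - 1)\<^sup>2) = (real n - 1)\<^sup>2"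
  by (simp add: of_nat_diff)

lemma choose_pred_2: "n \<ge> 1 \<Longrightarrow> real (n - 1 choose 2) = (real n - 1) * (real n - 2) / 2"
  by (simp add: real_choose of_nat_diff)

lemma choose_pred_3: "n \<ge> 1 \<Longrightarrow> real (n - 1 choose 3) = (real n - 1) * (real n - 2) * (real n - 3) / 6"
  by (simp add: real_choose of_nat_diff)

text \<open>For \<open>m = 1\<close> the truncated difference \<open>m\<^sup>2 - 4\<close> is harmless, as \<open>m choose 2\<close> vanishes.\<close>

lemma choose_two_mult_diff:
  "real (m choose 2) * real (m\<^sup>2 - 4) = real (m choose 2) * ((real m)\<^sup>2 - 4)"
proof (cases "m \<ge> 2")
  case True
  then have "2\<^sup>2 \<le> m\<^sup>2" by (rule power_mono) simp
  then show ?thesis by (simp add: of_nat_diff)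
qed simp

section \<open>Failure sets in terms of the ratio\<close>

lemma P_specs:
  assumes B: "B \<in> specs (n - 1) k" and n: "n \<ge> 1"
  shows "P_lcf n (entry_event n B) = (1 / 2) ^ (dom_size B + supp_size B)"
    "P_chio n (entry_event n B) = real_of_int (chio_ratio B) * P_lcf n (entry_event n B)"
proof -
  have "B \<in> arrays (dom B)" "dom B \<subseteq> square (n - 1)"
    using B by (simp_all add: mem_specs_iff)
  then show "P_lcf n (entry_event n B) = (1 / 2) ^ (dom_size B + supp_size B)"
    "P_chio n (entry_event n B) = real_of_int (chio_ratio B) * P_lcf n (entry_event n B)"
    using P_lcf_entry_event[of B "dom B" n] P_chio_entry_event[of B "dom B" n] n
    by (simp_all add: dom_size_def supp_size_def supp_def)
qed

text \<open>The lazy coin probability of an entry event is a power of 1/2, hence nonzero, and can be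
  cancelled.\<close>

lemma failures_eq:
  assumes "n \<ge> 1"
  shows "failures k n = {B \<in> specs (n - 1) k. chio_ratio B \<noteq> 1}"
proof -
  have "failures k n =
      {B \<in> specs (n - 1) k. P_chio n (entry_event n B) \<noteq> P_lcf n (entry_event n B)}"
    unfolding failures_def specs_def by blast
  also have "\<dots> = {B \<in> specs (n - 1) k. chio_ratio B \<noteq> 1}"
    using P_specs[OF _ assms] by (intro Collect_cong conj_cong refl) simp
  finally show ?thesis .
qed

lemma failures_ratio_eq:
  assumes "n \<ge> 1" "z \<noteq> 1"
  shows "failures_ratio (of_int z) k n = {B \<in> specs (n - 1) k. chio_ratio B = z}"
  unfolding failures_ratio_def failures_eq[OF assms(1)]
  using P_specs[OF _ assms(1)] assms(2) by auto

lemma entry_specs_dom_size: "{B \<in> entry_specs n. dom_size B = k} = specs (n - 1) k"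
  unfolding entry_specs_def specs_def dom_size_def using arrays_dom by blast

lemma card_entry_specs_le:
  "card {B \<in> entry_specs n. dom_size B \<le> d} = (\<Sum>k\<le>d. 3 ^ k * ((n - 1)\<^sup>2 choose k))"
proof -
  have "{B \<in> entry_specs n. dom_size B \<le> d} = (\<Union>k\<in>{..d}. {B \<in> entry_specs n. dom_size B = k})"
    by auto
  also have "card \<dots> = (\<Sum>k\<le>d. card {B \<in> entry_specs n. dom_size B = k})"
  proof (rule card_UN_disjoint)
    show "\<forall>k\<in>{..d}. finite {B \<in> entry_specs n. dom_size B = k}"
      unfolding entry_specs_dom_size by (simp add: finite_specs)
  qed auto
  finally show ?thesis
    unfolding entry_specs_dom_size by (simp add: card_specs)
qed

lemma chio_ratio_small:
  assumes B: "B \<in> specs m k" and k: "k \<le> 3"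
  shows "chio_ratio B = 1"
proof -
  have "T = {}" if T: "T \<in> cycle_space (supp B)" for T
  proof (rule ccontr)
    assume "T \<noteq> {}"
    have fin: "finite T" and le: "card T \<le> 3"
      using finite_supp_specs[OF B] cycle_space_subset[OF T] k card_mono[of "supp B" T]
      by (auto intro: finite_subset)
    from le have "card T \<le> 6" by simp
    from cycle_space_card[OF T fin \<open>T \<noteq> {}\<close> this] le show False by auto
  qed
  then have "cycle_space (supp B) = {{}}"
    using empty_in_cycle_space by blast
  then show ?thesis by (simp add: chio_ratio_def)
qed

text \<open>Twice the number of arrays with ratio 2 plus twelve times the number with ratio 4 is the
  number of pairs of array and cycle, whence the correction by \<open>6\<close>. Halving that number
  turns 16 and 6 * 64 into 8 and 192, and 32 is 128 / 4.\<close>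

lemma card_failures:
  assumes n: "n \<ge> 1" and k: "k \<le> 6"
  shows "real (card (failures_ratio 4 k n)) =
      (if k = 6 then 32 * real (n - 1 choose 2) * real (n - 1 choose 3) else 0)"
    "real (card (failures_ratio 2 k n)) =
      (if k \<ge> 4 then 8 * 3 ^ (k - 4) * (real (n - 1 choose 2))\<^sup>2 * real ((n - 1)\<^sup>2 - 4 choose (k - 4)) else 0) +
      (if k = 6 then 192 * (real (n - 1 choose 3))\<^sup>2 else 0) - 6 * real (card (failures_ratio 4 k n))"
    "real (card (failures_ratio 0 k n)) =
      real (card (failures_ratio 2 k n)) + 3 * real (card (failures_ratio 4 k n))"
    "real (card (failures k n)) = real (card (failures_ratio 0 k n)) +
      real (card (failures_ratio 2 k n)) + real (card (failures_ratio 4 k n))"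
proof -
  define m where "m = n - 1"
  define f where "f r = card {B \<in> specs m k. chio_ratio B = r}" for r
  have fr: "card (failures_ratio 0 k n) = f 0" "card (failures_ratio 2 k n) = f 2"
      "card (failures_ratio 4 k n) = f 4"
    using failures_ratio_eq[OF n, of 0] failures_ratio_eq[OF n, of 2] failures_ratio_eq[OF n, of 4]
    by (simp_all add: f_def m_def)
  note ratio = card_ratio[OF k, of m, folded f_def]
  have f4: "4 * f 4 = (if k = 6 then 128 * (m choose 2) * (m choose 3) else 0)"
    using ratio(2) card_cyclic_specs_4[OF k, of m] by simp
  have "2 * f 2 + 12 * f 4 =
      (if k \<ge> 4 then (m choose 2)\<^sup>2 * (16 * 3 ^ (k - 4) * ((m\<^sup>2 - 4) choose (k - 4))) else 0) +
      (if k = 6 then 6 * (m choose 3)\<^sup>2 * 64 else 0)"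
    using ratio(1,2) sum_cyclic_specs[OF k, of m] sum_cycles[OF k, of m] by simp
  then have "real (2 * f 2 + 12 * f 4) =
      real ((if k \<ge> 4 then (m choose 2)\<^sup>2 * (16 * 3 ^ (k - 4) * ((m\<^sup>2 - 4) choose (k - 4))) else 0) +
      (if k = 6 then 6 * (m choose 3)\<^sup>2 * 64 else 0))"
    by (simp only:)
  then show "real (card (failures_ratio 2 k n)) =
      (if k \<ge> 4 then 8 * 3 ^ (k - 4) * (real (n - 1 choose 2))\<^sup>2 * real ((n - 1)\<^sup>2 - 4 choose (k - 4)) else 0) +
      (if k = 6 then 192 * (real (n - 1 choose 3))\<^sup>2 else 0) - 6 * real (card (failures_ratio 4 k n))"
    unfolding fr m_def by (simp add: algebra_simps split: if_splits)
  have "real (4 * f 4) = real (if k = 6 then 128 * (m choose 2) * (m choose 3) else 0)"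
    by (simp only: f4)
  then show "real (card (failures_ratio 4 k n)) =
      (if k = 6 then 32 * real (n - 1 choose 2) * real (n - 1 choose 3) else 0)"
    unfolding fr m_def by (simp split: if_splits)
  show "real (card (failures_ratio 0 k n)) =
      real (card (failures_ratio 2 k n)) + 3 * real (card (failures_ratio 4 k n))"
    unfolding fr ratio(3) by simp
  show "real (card (failures k n)) = real (card (failures_ratio 0 k n)) +
      real (card (failures_ratio 2 k n)) + real (card (failures_ratio 4 k n))"
    unfolding fr failures_eq[OF n] using ratio(4) by (simp add: m_def)
qed

lemma finite_failures: "n \<ge> 1 \<Longrightarrow> finite (failures k n)"
  by (simp add: failures_eq finite_specs)

text \<open>With at most five specified cells no cycle space of order 4 occurs, so ratios 0 and 2
  are equally frequent and are the only failures.\<close>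

lemma failures_ratio_half:
  assumes n: "n \<ge> 1" and k: "k \<le> 5" and ne: "failures k n \<noteq> {}"
  shows "real (card (failures_ratio 0 k n)) / real (card (failures k n)) = 1 / 2"
    "real (card (failures_ratio 2 k n)) / real (card (failures k n)) = 1 / 2"
proof -
  have "card (failures k n) > 0"
    using ne finite_failures[OF n] by (simp add: card_gt_0_iff)
  moreover have "real (card (failures k n)) = 2 * real (card (failures_ratio 2 k n))"
      "real (card (failures_ratio 0 k n)) = real (card (failures_ratio 2 k n))"
    using card_failures[OF n, of k] k by simp_all
  ultimately show "real (card (failures_ratio 0 k n)) / real (card (failures k n)) = 1 / 2"
    "real (card (failures_ratio 2 k n)) / real (card (failures k n)) = 1 / 2"
    by (simp_all add: field_simps)
qed

lemma choose_two_square_mult_choose: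
  "(real (m choose 2))\<^sup>2 * real (m\<^sup>2 - 4 choose 2) =
    (real (m choose 2))\<^sup>2 * (((real m)\<^sup>2 - 4) * ((real m)\<^sup>2 - 5) / 2)"
proof (cases "m \<ge> 2")
  case True
  then have "2\<^sup>2 \<le> m\<^sup>2" by (rule power_mono) simp
  then show ?thesis by (simp add: real_choose of_nat_diff)
qed simp

lemma card_failures_4: "n \<ge> 1 \<Longrightarrow> card (failures 4 n) = 2 ^ 4 * (n - 1 choose 2) * (n - 1 choose 2)"
proof -
  assume "n \<ge> 1"
  then have "real (card (failures 4 n)) = real (2 ^ 4 * (n - 1 choose 2) * (n - 1 choose 2))"
    using card_failures[of n 4] by (simp add: power2_eq_square)
  then show ?thesis by (simp only: of_nat_eq_iff)
qed

lemma card_failures_5: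
  assumes "n \<ge> 1"
  shows "real (card (failures 5 n)) =
    48 * ((real n - 1)\<^sup>2 - 4) * real (n - 1 choose 2) * real (n - 1 choose 2)"
proof -
  have "real (card (failures 5 n)) =
      48 * real (n - 1 choose 2) * (real (n - 1 choose 2) * real ((n - 1)\<^sup>2 - 4))"
    using card_failures[of n 5] assms by (simp add: power2_eq_square)
  also have "real (n - 1 choose 2) * real ((n - 1)\<^sup>2 - 4) =
      real (n - 1 choose 2) * ((real n - 1)\<^sup>2 - 4)"
    using choose_two_mult_diff[of "n - 1"] assms by (simp add: of_nat_diff)
  finally show ?thesis by (simp only: mult_ac)
qed

lemma card_failures_6:
  assumes n: "n \<ge> 1"
  shows "real (card (failures 6 n)) =
           18 * real n ^ 8 - 180 * real n ^ 7 + 1868 / 3 * real n ^ 6 - 2176 / 3 * real n ^ 5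
           - 754 / 3 * real n ^ 4 + 428 / 3 * real n ^ 3 + 8144 / 3 * real n ^ 2
           - 11536 / 3 * real n + 1504" (is ?all)
    "real (card (failures_ratio 0 6 n)) =
           9 * real n ^ 8 - 90 * real n ^ 7 + 934 / 3 * real n ^ 6 - 360 * real n ^ 5
           - 449 / 3 * real n ^ 4 + 154 * real n ^ 3 + 3664 / 3 * real n ^ 2
           - 1816 * real n + 720" (is ?zero)
    "real (card (failures_ratio 2 6 n)) =
           9 * real n ^ 8 - 90 * real n ^ 7 + 934 / 3 * real n ^ 6 - 368 * real n ^ 5
           - 233 / 3 * real n ^ 4 - 94 * real n ^ 3 + 4888 / 3 * real n ^ 2
           - 2136 * real n + 816" (is ?two)
    "real (card (failures_ratio 4 6 n)) =
           8 / 3 * real n ^ 5 - 24 * real n ^ 4 + 248 / 3 * real n ^ 3 - 136 * real n ^ 2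
           + 320 / 3 * real n - 32" (is ?four)
proof -
  note f = card_failures[OF n order.refl]
  have x: "real (n - 1) = real n - 1" using n by (simp add: of_nat_diff)
  have "real (card (failures_ratio 4 6 n)) =
      32 * ((real n - 1) * (real n - 2) / 2) * ((real n - 1) * (real n - 2) * (real n - 3) / 6)"
    unfolding f(1) choose_pred_2[OF n] choose_pred_3[OF n] by simp
  also have "\<dots> = 8 / 3 * real n ^ 5 - 24 * real n ^ 4 + 248 / 3 * real n ^ 3 - 136 * real n ^ 2
      + 320 / 3 * real n - 32"
    by (simp add: field_simps eval_nat_numeral)
  finally show f4: ?four .
  \<comment> \<open>Here 72 = 8 * 3^2, the two extra cells being unrestricted. The factors are
    grouped so that the truncated difference stands next to a binomial coefficient that vanishes
    where truncation matters.\<close>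
  have "real (card (failures_ratio 2 6 n)) =
      72 * ((real (n - 1 choose 2))\<^sup>2 * real ((n - 1)\<^sup>2 - 4 choose 2)) +
      192 * (real (n - 1 choose 3))\<^sup>2 - 6 * real (card (failures_ratio 4 6 n))"
    unfolding f(2) by simp
  also have "\<dots> = 72 * (((real n - 1) * (real n - 2) / 2)\<^sup>2 *
        (((real n - 1)\<^sup>2 - 4) * ((real n - 1)\<^sup>2 - 5) / 2)) +
      192 * ((real n - 1) * (real n - 2) * (real n - 3) / 6)\<^sup>2 -
      6 * (8 / 3 * real n ^ 5 - 24 * real n ^ 4 + 248 / 3 * real n ^ 3 - 136 * real n ^ 2
      + 320 / 3 * real n - 32)"
    unfolding choose_two_square_mult_choose unfolding f4 choose_pred_2[OF n] choose_pred_3[OF n] x ..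
  also have "\<dots> = 9 * real n ^ 8 - 90 * real n ^ 7 + 934 / 3 * real n ^ 6 - 368 * real n ^ 5
           - 233 / 3 * real n ^ 4 - 94 * real n ^ 3 + 4888 / 3 * real n ^ 2
           - 2136 * real n + 816"
    by (simp add: field_simps eval_nat_numeral)
  finally show f2: ?two .
  show f0: ?zero
    unfolding f(3) f2 f4 by simp
  show ?all
    unfolding f(4) f0 f2 f4 by simp
qed

section \<open>Asymptotics and the final statement\<close>

lemma asymp_equiv_from_2:
  fixes f g h :: "nat \<Rightarrow> real"
  assumes "\<And>n. n \<ge> 2 \<Longrightarrow> f n = g n" "g \<sim>[at_top] h"
  shows "f \<sim>[at_top] h"
proof -
  have "eventually (\<lambda>n. f n = g n) at_top"
    using eventually_ge_at_top[of 2] by eventually_elim (rule assms(1))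
  then show ?thesis
    using asymp_equiv_cong[of f g at_top h h] assms(2) by simp
qed

text \<open>The proportions 1/2 are asserted where there are failures at all: for
  \<open>n = 2\<close> the inner square is a single cell, the failure sets are empty and the
  quotients would be 0 / 0.\<close>

theorem theorem51:
  shows
    "((\<forall>n\<ge>2.
         card {B \<in> entry_specs n. dom_size B \<le> 3} = (\<Sum>k\<le>3. 3 ^ k * ((n - 1)\<^sup>2 choose k)) \<and>
         (\<forall>B\<in>entry_specs n. dom_size B \<le> 3 \<longrightarrow>
            P_chio n (entry_event n B) = P_lcf n (entry_event n B) \<and>
            P_lcf n (entry_event n B) = (1 / 2) ^ (dom_size B + supp_size B))) \<and>
      (\<lambda>n. real (\<Sum>k\<le>3. 3 ^ k * ((n - 1)\<^sup>2 choose k))) \<sim>[at_top] (\<lambda>n. 9 / 2 * real n ^ 6))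
     \<and>
     ((\<forall>n\<ge>2.
         card {B \<in> entry_specs n. dom_size B = 4} = 3 ^ 4 * ((n - 1)\<^sup>2 choose 4) \<and>
         card (failures 4 n) = 2 ^ 4 * (n - 1 choose 2) * (n - 1 choose 2) \<and>
         (failures 4 n \<noteq> {} \<longrightarrow>
            real (card (failures_ratio 0 4 n)) / real (card (failures 4 n)) = 1 / 2 \<and>
            real (card (failures_ratio 2 4 n)) / real (card (failures 4 n)) = 1 / 2)) \<and>
      (\<lambda>n. real (3 ^ 4 * ((n - 1)\<^sup>2 choose 4))) \<sim>[at_top] (\<lambda>n. 27 / 8 * real n ^ 8) \<and>
      (\<lambda>n. real (card (failures 4 n))) \<sim>[at_top] (\<lambda>n. 4 * real n ^ 4))
     \<and>
     ((\<forall>n\<ge>2.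
         card {B \<in> entry_specs n. dom_size B = 5} = 3 ^ 5 * ((n - 1)\<^sup>2 choose 5) \<and>
         real (card (failures 5 n)) =
           48 * ((real n - 1)\<^sup>2 - 4) * real (n - 1 choose 2) * real (n - 1 choose 2) \<and>
         (failures 5 n \<noteq> {} \<longrightarrow>
            real (card (failures_ratio 0 5 n)) / real (card (failures 5 n)) = 1 / 2 \<and>
            real (card (failures_ratio 2 5 n)) / real (card (failures 5 n)) = 1 / 2)) \<and>
      (\<lambda>n. real (3 ^ 5 * ((n - 1)\<^sup>2 choose 5))) \<sim>[at_top] (\<lambda>n. 81 / 40 * real n ^ 10) \<and>
      (\<lambda>n. real (card (failures 5 n))) \<sim>[at_top] (\<lambda>n. 12 * real n ^ 6))
     \<and>
     ((\<forall>n\<ge>2.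
         card {B \<in> entry_specs n. dom_size B = 6} = 3 ^ 6 * ((n - 1)\<^sup>2 choose 6) \<and>
         real (card (failures 6 n)) =
           18 * real n ^ 8 - 180 * real n ^ 7 + 1868 / 3 * real n ^ 6 - 2176 / 3 * real n ^ 5
           - 754 / 3 * real n ^ 4 + 428 / 3 * real n ^ 3 + 8144 / 3 * real n ^ 2
           - 11536 / 3 * real n + 1504 \<and>
         real (card (failures_ratio 0 6 n)) =
           9 * real n ^ 8 - 90 * real n ^ 7 + 934 / 3 * real n ^ 6 - 360 * real n ^ 5
           - 449 / 3 * real n ^ 4 + 154 * real n ^ 3 + 3664 / 3 * real n ^ 2
           - 1816 * real n + 720 \<and>
         real (card (failures_ratio 2 6 n)) =
           9 * real n ^ 8 - 90 * real n ^ 7 + 934 / 3 * real n ^ 6 - 368 * real n ^ 5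
           - 233 / 3 * real n ^ 4 - 94 * real n ^ 3 + 4888 / 3 * real n ^ 2
           - 2136 * real n + 816 \<and>
         real (card (failures_ratio 4 6 n)) =
           8 / 3 * real n ^ 5 - 24 * real n ^ 4 + 248 / 3 * real n ^ 3 - 136 * real n ^ 2
           + 320 / 3 * real n - 32) \<and>
      (\<lambda>n. real (3 ^ 6 * ((n - 1)\<^sup>2 choose 6))) \<sim>[at_top] (\<lambda>n. 81 / 80 * real n ^ 12) \<and>
      (\<lambda>n. real (card (failures 6 n))) \<sim>[at_top] (\<lambda>n. 18 * real n ^ 8) \<and>
      (\<lambda>n. real (card (failures_ratio 0 6 n))) \<sim>[at_top] (\<lambda>n. 9 * real n ^ 8) \<and>
      (\<lambda>n. real (card (failures_ratio 2 6 n))) \<sim>[at_top] (\<lambda>n. 9 * real n ^ 8) \<and>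
      (\<lambda>n. real (card (failures_ratio 4 6 n))) \<sim>[at_top] (\<lambda>n. 8 / 3 * real n ^ 5) \<and>
      (\<lambda>n. real (card (failures_ratio 0 6 n)) / real (card (failures 6 n))) \<longlonglongrightarrow> 1 / 2 \<and>
      (\<lambda>n. real (card (failures_ratio 2 6 n)) / real (card (failures 6 n))) \<longlonglongrightarrow> 1 / 2 \<and>
      (\<lambda>n. real (card (failures_ratio 4 6 n)) / real (card (failures 6 n))) \<longlonglongrightarrow> 0)"
proof -
  have ex3: "card {B \<in> entry_specs n. dom_size B \<le> 3} = (\<Sum>k\<le>3. 3 ^ k * ((n - 1)\<^sup>2 choose k)) \<and>
      (\<forall>B\<in>entry_specs n. dom_size B \<le> 3 \<longrightarrow>
        P_chio n (entry_event n B) = P_lcf n (entry_event n B) \<and>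
        P_lcf n (entry_event n B) = (1 / 2) ^ (dom_size B + supp_size B))" if "n \<ge> 2" for n
  proof (intro conjI ballI impI card_entry_specs_le)
    fix B assume B: "B \<in> entry_specs n" "dom_size B \<le> 3"
    then have S: "B \<in> specs (n - 1) (dom_size B)"
      using entry_specs_dom_size[of n "dom_size B"] by blast
    have n: "n \<ge> 1" using that by simp
    show "P_chio n (entry_event n B) = P_lcf n (entry_event n B)"
      using P_specs(2)[OF S n] chio_ratio_small[OF S B(2)] by simp
    show "P_lcf n (entry_event n B) = (1 / 2) ^ (dom_size B + supp_size B)"
      by (rule P_specs(1)[OF S n])
  qed
  have ex456: "card {B \<in> entry_specs n. dom_size B = k} = 3 ^ k * ((n - 1)\<^sup>2 choose k)" for n k
    unfolding entry_specs_dom_size by (rule card_specs)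
  have sum3: "real (\<Sum>k\<le>3. 3 ^ k * ((n - 1)\<^sup>2 choose k)) =
      1 + 3 * (real n - 1)\<^sup>2 + 9 * ((real n - 1)\<^sup>2 * ((real n - 1)\<^sup>2 - 1) / 2) +
      27 * ((real n - 1)\<^sup>2 * ((real n - 1)\<^sup>2 - 1) * ((real n - 1)\<^sup>2 - 2) / 6)" if "n \<ge> 2" for n
  proof -
    have "(\<Sum>k\<le>3. 3 ^ k * (N choose k)) = 1 + 3 * N + 9 * (N choose 2) + 27 * (N choose 3)" for N :: nat
      by (simp add: numeral_eq_Suc)
    moreover have "n \<ge> 1" using that by simp
    ultimately show ?thesis
      using pred_square[of n] by (simp add: real_choose)
  qed
  have asymp3: "(\<lambda>n. real (\<Sum>k\<le>3. 3 ^ k * ((n - 1)\<^sup>2 choose k))) \<sim>[at_top] (\<lambda>n. 9 / 2 * real n ^ 6)"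
    by (rule asymp_equiv_from_2[OF sum3]) (assumption, real_asymp)
  have asymp4: "(\<lambda>n. real (3 ^ 4 * ((n - 1)\<^sup>2 choose 4))) \<sim>[at_top] (\<lambda>n. 27 / 8 * real n ^ 8)"
  proof (rule asymp_equiv_from_2)
    show "real (3 ^ 4 * ((n - 1)\<^sup>2 choose 4)) =
      81 * ((real n - 1)\<^sup>2 * ((real n - 1)\<^sup>2 - 1) * ((real n - 1)\<^sup>2 - 2) * ((real n - 1)\<^sup>2 - 3) / 24)"
      if "n \<ge> 2" for n
      using pred_square[of n] that by (simp add: real_choose)
  qed real_asymp
  have asymp5: "(\<lambda>n. real (3 ^ 5 * ((n - 1)\<^sup>2 choose 5))) \<sim>[at_top] (\<lambda>n. 81 / 40 * real n ^ 10)"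
  proof (rule asymp_equiv_from_2)
    show "real (3 ^ 5 * ((n - 1)\<^sup>2 choose 5)) =
      243 * ((real n - 1)\<^sup>2 * ((real n - 1)\<^sup>2 - 1) * ((real n - 1)\<^sup>2 - 2) * ((real n - 1)\<^sup>2 - 3) *
        ((real n - 1)\<^sup>2 - 4) / 120)" if "n \<ge> 2" for n
      using pred_square[of n] that by (simp add: real_choose)
  qed real_asymp
  have asymp6: "(\<lambda>n. real (3 ^ 6 * ((n - 1)\<^sup>2 choose 6))) \<sim>[at_top] (\<lambda>n. 81 / 80 * real n ^ 12)"
  proof (rule asymp_equiv_from_2)
    show "real (3 ^ 6 * ((n - 1)\<^sup>2 choose 6)) =
      729 * ((real n - 1)\<^sup>2 * ((real n - 1)\<^sup>2 - 1) * ((real n - 1)\<^sup>2 - 2) * ((real n - 1)\<^sup>2 - 3) *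
        ((real n - 1)\<^sup>2 - 4) * ((real n - 1)\<^sup>2 - 5) / 720)" if "n \<ge> 2" for n
      using pred_square[of n] that by (simp add: real_choose)
  qed real_asymp
  have failures4: "(\<lambda>n. real (card (failures 4 n))) \<sim>[at_top] (\<lambda>n. 4 * real n ^ 4)"
  proof (rule asymp_equiv_from_2)
    show "real (card (failures 4 n)) = 4 * ((real n - 1) * (real n - 2)) ^ 2" if "n \<ge> 2" for n
    proof -
      have n: "n \<ge> 1" using that by simp
      have "real (card (failures 4 n)) = 16 * (real (n - 1 choose 2))\<^sup>2"
        unfolding card_failures_4[OF n] by (simp add: power2_eq_square)
      then show ?thesis
        unfolding choose_pred_2[OF n] by (simp add: power_divide)
    qed
  qed real_asymp
  have failures5: "(\<lambda>n. real (card (failures 5 n))) \<sim>[at_top] (\<lambda>n. 12 * real n ^ 6)"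
  proof (rule asymp_equiv_from_2)
    show "real (card (failures 5 n)) =
        12 * ((real n - 1)\<^sup>2 - 4) * ((real n - 1) * (real n - 2)) ^ 2" if "n \<ge> 2" for n
    proof -
      have n: "n \<ge> 1" using that by simp
      show ?thesis
        unfolding card_failures_5[OF n] choose_pred_2[OF n] by algebra
    qed
  qed real_asymp
  note c6 = card_failures_6[OF order_trans[of 1 2]]
  have failures6: "(\<lambda>n. real (card (failures 6 n))) \<sim>[at_top] (\<lambda>n. 18 * real n ^ 8)"
    "(\<lambda>n. real (card (failures_ratio 0 6 n))) \<sim>[at_top] (\<lambda>n. 9 * real n ^ 8)"
    "(\<lambda>n. real (card (failures_ratio 2 6 n))) \<sim>[at_top] (\<lambda>n. 9 * real n ^ 8)"
    "(\<lambda>n. real (card (failures_ratio 4 6 n))) \<sim>[at_top] (\<lambda>n. 8 / 3 * real n ^ 5)"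
    by (rule asymp_equiv_from_2, rule c6, simp, assumption, real_asymp)+
  \<comment> \<open>Asymptotic equivalence passes to quotients, so each limit is that of the
    quotient of leading terms; for ratio 4 this has order n^5 / n^8 and tends to 0.\<close>
  have ratios: "(\<lambda>n. real (card (failures_ratio z 6 n)) / real (card (failures 6 n))) \<longlonglongrightarrow> L"
    if "(\<lambda>n. real (card (failures_ratio z 6 n))) \<sim>[at_top] g" "(\<lambda>n. g n / (18 * real n ^ 8)) \<longlonglongrightarrow> L" for z g L
  proof -
    have "(\<lambda>n. real (card (failures_ratio z 6 n)) / real (card (failures 6 n))) \<sim>[at_top]
        (\<lambda>n. g n / (18 * real n ^ 8))"
      using that(1) failures6(1) by (rule asymp_equiv_intros)
    then show ?thesis
      using that(2) by (simp add: tendsto_asymp_equiv_cong)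
  qed
  have limits: "(\<lambda>n. real (card (failures_ratio 0 6 n)) / real (card (failures 6 n))) \<longlonglongrightarrow> 1 / 2"
    "(\<lambda>n. real (card (failures_ratio 2 6 n)) / real (card (failures 6 n))) \<longlonglongrightarrow> 1 / 2"
    "(\<lambda>n. real (card (failures_ratio 4 6 n)) / real (card (failures 6 n))) \<longlonglongrightarrow> 0"
    by (rule ratios[OF failures6(2)], real_asymp) (rule ratios[OF failures6(3)], real_asymp,
      rule ratios[OF failures6(4)], real_asymp)
  show ?thesis
    by (intro conjI allI impI ex456 asymp3 asymp4 asymp5 asymp6 failures4 failures5 failures6 limits
        ex3[THEN conjunct1] ex3[THEN conjunct2] card_failures_4 card_failures_5 c6 failures_ratio_half)
      simp_all
qed

end
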